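(* Let $a<b<c$ be integers, $\chi(x)=(x-a)(x-b)(x-c)$ and $R=\mathbb{Z}[x]/(\chi(x))$. If $c-a\le 3$, then $\mathrm{Cl}(R)$ is trivial. If $c-a\ge 4$, then $\mathrm{Cl}(R)$ is isomorphic to the quotient of the group $$G=\Big(\mathbb{Z}/(b-a)(c-a)\Big)^\times\times\Big(\mathbb{Z}/(c-b)(c-a)\Big)^\times$$ by the subgroup $N$ which is the (internal) direct product $HK$ of the subgroups $H$ and $K$ of $G$, where $$H=\{(\overline{1},\overline{1}),(\overline{1},-\overline{1}),(-\overline{1},\overline{1}),(-\overline{1},-\overline{1})\},$$ $$K=\Big\{(\overline{u},\overline{v})\in G:\ b-a\mid u-1,\ \ c-b\mid v-1,\ \ c-a\ \Big|\ \frac{u(v-1)}{c-b}-\frac{u-1}{b-a}\Big\}.$$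
   Context: Put $K_0=\mathbb{Q}\otimes_{\mathbb{Z}}R\cong\mathbb{Q}[x]/(\chi(x))$. A fractional $R$-ideal is an $R$-submodule $I\subset K_0$ that is a free $\mathbb{Z}$-module of rank $3$. Fractional ideals are multiplied in the usual way. Two fractional $R$-ideals $I,J$ are equivalent if $I=kJ$ for some $k\in K_0^\times$. The ideal class monoid $\mathrm{ICM}(R)$ is the monoid of equivalence classes of fractional $R$-ideals. A fractional $R$-ideal $I$ is invertible if $IJ=R$ for some fractional $R$-ideal $J$. The ideal class group $\mathrm{Cl}(R)$ is the subgroup of $\mathrm{ICM}(R)$ consisting of classes of invertible fractional $R$-ideals. $\mathbb{Z}/(b-a)(c-a)$ and $\mathbb{Z}/(c-b)(c-a)$ denote the rings of integers modulo $(b-a)(c-a)$ and modulo $(c-b)(c-a)$. In the definition of $K$, $u$ and $v$ are integers representing the residue classes $\overline u$ and $\overline v$; the conditions do not depend on the choice of representatives. *)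

theory Defs
  imports
    "HOL-Algebra.Algebra"
    "HOL-Algebra.Algebraic_Closure_Type"
    "HOL-Number_Theory.Residues"
begin

text \<open>
  \<open>ring_of_type_algebra\<close> is the type \<open>'a poly\<close> (the polynomials of the computational algebra
  library) regarded as a ring with explicit carrier.
\<close>

abbreviation polys :: "'a :: comm_ring_1 poly ring"
  where "polys \<equiv> ring_of_type_algebra"

definition chi :: "int \<Rightarrow> int \<Rightarrow> int \<Rightarrow> 'a :: comm_ring_1 poly"
  where "chi a b c = [:- of_int a, 1:] * [:- of_int b, 1:] * [:- of_int c, 1:]"

definition order_R :: "int \<Rightarrow> int \<Rightarrow> int \<Rightarrow> int poly set ring"
  where "order_R a b c = polys Quot (PIdl\<^bsub>polys\<^esub> (chi a b c))"

text \<open>The algebra \<open>\<rat> \<otimes> R\<close>, in its presentation as \<open>\<rat>[x]/(\<chi>(x))\<close>.\<close>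

definition alg_K\<^sub>0 :: "int \<Rightarrow> int \<Rightarrow> int \<Rightarrow> rat poly set ring"
  where "alg_K\<^sub>0 a b c = polys Quot (PIdl\<^bsub>polys\<^esub> (chi a b c))"

text \<open>
  The canonical map \<open>R \<rightarrow> K\<^sub>0\<close>. A residue class \<open>r\<close> is a set of integer polynomials; all of them
  have the same residue class over the rationals, so that the union is over a single coset (lemma
  \<open>R_to_K\<^sub>0_coset\<close> below).
\<close>

definition R_to_K\<^sub>0 :: "int \<Rightarrow> int \<Rightarrow> int \<Rightarrow> int poly set \<Rightarrow> rat poly set"
  where "R_to_K\<^sub>0 a b c r =
    (\<Union>p\<in>r. PIdl\<^bsub>polys\<^esub> (chi a b c) +>\<^bsub>polys\<^esub> map_poly rat_of_int p)"

definition mod_K\<^sub>0 :: "int \<Rightarrow> int \<Rightarrow> int \<Rightarrow> (int poly set, rat poly set) module"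
  where "mod_K\<^sub>0 a b c = ring.extend (alg_K\<^sub>0 a b c)
    \<lparr>module.smult = \<lambda>r x. R_to_K\<^sub>0 a b c r \<otimes>\<^bsub>alg_K\<^sub>0 a b c\<^esub> x\<rparr>"

lemma cring_polys: "cring (polys :: 'a :: comm_ring_1 poly ring)"
  by (rule cring_from_type_algebra)

lemma ideal_chi: "ideal (PIdl\<^bsub>polys\<^esub> (chi a b c :: 'a :: comm_ring_1 poly)) polys"
  by (rule cring.cgenideal_ideal[OF cring_polys]) (simp add: ring_of_type_algebra_def)

lemma cring_order_R: "cring (order_R a b c)"
  unfolding order_R_def by (rule ideal.quotient_is_cring[OF ideal_chi cring_polys])

lemma cring_alg_K\<^sub>0: "cring (alg_K\<^sub>0 a b c)"
  unfolding alg_K\<^sub>0_def by (rule ideal.quotient_is_cring[OF ideal_chi cring_polys])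

lemma mem_coset_iff:
  fixes p q :: "'a :: comm_ring_1 poly"
  shows "q \<in> PIdl\<^bsub>polys\<^esub> (chi a b c) +>\<^bsub>polys\<^esub> p \<longleftrightarrow> chi a b c dvd q - p"
proof -
  have "q \<in> PIdl\<^bsub>polys\<^esub> (chi a b c) +>\<^bsub>polys\<^esub> p \<longleftrightarrow> (\<exists>s. q = s * chi a b c + p)"
    by (auto simp: a_r_coset_def r_coset_def cgenideal_def ring_of_type_algebra_def)
  also have "\<dots> \<longleftrightarrow> (\<exists>s. q - p = chi a b c * s)"
    by (simp add: diff_eq_eq mult.commute)
  finally show ?thesis unfolding dvd_def .
qed

lemma coset_eq_iff:
  fixes p q :: "'a :: comm_ring_1 poly"
  shows "PIdl\<^bsub>polys\<^esub> (chi a b c) +>\<^bsub>polys\<^esub> p = PIdl\<^bsub>polys\<^esub> (chi a b c) +>\<^bsub>polys\<^esub> q \<longleftrightarrow>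
         chi a b c dvd p - q"
proof
  assume *: "chi a b c dvd p - q"
  have "chi a b c dvd s - q \<longleftrightarrow> chi a b c dvd s - p" for s
  proof -
    have "s - q = (p - q) + (s - p)" by simp
    then show ?thesis using dvd_add_right_iff[OF *] by metis
  qed
  then show "PIdl\<^bsub>polys\<^esub> (chi a b c) +>\<^bsub>polys\<^esub> p = PIdl\<^bsub>polys\<^esub> (chi a b c) +>\<^bsub>polys\<^esub> q"
    unfolding set_eq_iff mem_coset_iff by simp
next
  assume "PIdl\<^bsub>polys\<^esub> (chi a b c) +>\<^bsub>polys\<^esub> p = PIdl\<^bsub>polys\<^esub> (chi a b c) +>\<^bsub>polys\<^esub> q"
  moreover have "p \<in> PIdl\<^bsub>polys\<^esub> (chi a b c) +>\<^bsub>polys\<^esub> p"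
    unfolding mem_coset_iff by simp
  ultimately show "chi a b c dvd p - q" unfolding mem_coset_iff[symmetric] by simp
qed

lemma map_poly_chi: "map_poly rat_of_int (chi a b c) = chi a b c"
  unfolding chi_def by (simp add: map_poly_pCons)

lemma map_poly_rat_add: "map_poly rat_of_int (p + q) = map_poly rat_of_int p + map_poly rat_of_int q"
  by (simp add: poly_eq_iff coeff_map_poly)

lemma map_poly_rat_diff: "map_poly rat_of_int (p - q) = map_poly rat_of_int p - map_poly rat_of_int q"
  by (simp add: poly_eq_iff coeff_map_poly)

lemma map_poly_rat_mult: "map_poly rat_of_int (p * q) = map_poly rat_of_int p * map_poly rat_of_int q"
  by (simp add: poly_eq_iff coeff_map_poly coeff_mult)

lemma R_to_K\<^sub>0_coset:
  "R_to_K\<^sub>0 a b c (PIdl\<^bsub>polys\<^esub> (chi a b c) +>\<^bsub>polys\<^esub> p) =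
   PIdl\<^bsub>polys\<^esub> (chi a b c) +>\<^bsub>polys\<^esub> map_poly rat_of_int p"
proof -
  let ?C = "\<lambda>q. PIdl\<^bsub>polys\<^esub> (chi a b c) +>\<^bsub>polys\<^esub> map_poly rat_of_int q"
  have "?C q = ?C p" if q: "q \<in> PIdl\<^bsub>polys\<^esub> (chi a b c) +>\<^bsub>polys\<^esub> p" for q
  proof -
    from q obtain s where "q - p = chi a b c * s"
      unfolding mem_coset_iff dvd_def by blast
    then have "map_poly rat_of_int q - map_poly rat_of_int p = chi a b c * map_poly rat_of_int s"
      by (metis map_poly_chi map_poly_rat_diff map_poly_rat_mult)
    then show ?thesis unfolding coset_eq_iff by simp
  qed
  moreover have "p \<in> PIdl\<^bsub>polys\<^esub> (chi a b c) +>\<^bsub>polys\<^esub> p"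
    unfolding mem_coset_iff by simp
  ultimately show ?thesis unfolding R_to_K\<^sub>0_def by blast
qed

lemma carrier_order_R:
  "carrier (order_R a b c) = range (\<lambda>p. PIdl\<^bsub>polys\<^esub> (chi a b c) +>\<^bsub>polys\<^esub> p)"
  by (simp add: order_R_def FactRing_simps full_SetCompr_eq UNION_singleton_eq_range
      a_r_coset_def ring_of_type_algebra_def)

lemma carrier_alg_K\<^sub>0:
  "carrier (alg_K\<^sub>0 a b c) = range (\<lambda>p. PIdl\<^bsub>polys\<^esub> (chi a b c) +>\<^bsub>polys\<^esub> p)"
  by (simp add: alg_K\<^sub>0_def FactRing_simps full_SetCompr_eq UNION_singleton_eq_range
      a_r_coset_def ring_of_type_algebra_def)

lemma R_to_K\<^sub>0_hom: "R_to_K\<^sub>0 a b c \<in> ring_hom (order_R a b c) (alg_K\<^sub>0 a b c)"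
proof -
  let ?Z = "\<lambda>p :: int poly. PIdl\<^bsub>polys\<^esub> (chi a b c) +>\<^bsub>polys\<^esub> p"
  let ?Q = "\<lambda>p :: rat poly. PIdl\<^bsub>polys\<^esub> (chi a b c) +>\<^bsub>polys\<^esub> p"
  have Z: "?Z \<in> ring_hom polys (order_R a b c)"
    unfolding order_R_def by (rule ideal.rcos_ring_hom[OF ideal_chi])
  have Q: "?Q \<in> ring_hom polys (alg_K\<^sub>0 a b c)"
    unfolding alg_K\<^sub>0_def by (rule ideal.rcos_ring_hom[OF ideal_chi])
  have UZ: "p \<in> carrier polys" for p :: "int poly"
    by (simp add: ring_of_type_algebra_def)
  have UQ: "p \<in> carrier polys" for p :: "rat poly"
    by (simp add: ring_of_type_algebra_def)
  have Zm: "?Z p \<otimes>\<^bsub>order_R a b c\<^esub> ?Z q = ?Z (p * q)"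
    and Za: "?Z p \<oplus>\<^bsub>order_R a b c\<^esub> ?Z q = ?Z (p + q)" for p q
    using ring_hom_mult[OF Z UZ UZ, of p q] ring_hom_add[OF Z UZ UZ, of p q]
    by (simp_all add: ring_of_type_algebra_def)
  have Qm: "?Q p \<otimes>\<^bsub>alg_K\<^sub>0 a b c\<^esub> ?Q q = ?Q (p * q)"
    and Qa: "?Q p \<oplus>\<^bsub>alg_K\<^sub>0 a b c\<^esub> ?Q q = ?Q (p + q)" for p q
    using ring_hom_mult[OF Q UQ UQ, of p q] ring_hom_add[OF Q UQ UQ, of p q]
    by (simp_all add: ring_of_type_algebra_def)
  have ones: "\<one>\<^bsub>order_R a b c\<^esub> = ?Z 1" "\<one>\<^bsub>alg_K\<^sub>0 a b c\<^esub> = ?Q 1"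
    by (simp_all add: order_R_def alg_K\<^sub>0_def FactRing_def ring_of_type_algebra_def)
  show ?thesis
  proof (rule ring_hom_memI)
    fix x y assume "x \<in> carrier (order_R a b c)" "y \<in> carrier (order_R a b c)"
    then obtain p q where xy: "x = ?Z p" "y = ?Z q" unfolding carrier_order_R by blast
    show "R_to_K\<^sub>0 a b c (x \<otimes>\<^bsub>order_R a b c\<^esub> y) =
        R_to_K\<^sub>0 a b c x \<otimes>\<^bsub>alg_K\<^sub>0 a b c\<^esub> R_to_K\<^sub>0 a b c y"
      by (simp only: xy Zm Qm R_to_K\<^sub>0_coset map_poly_rat_mult)
    show "R_to_K\<^sub>0 a b c (x \<oplus>\<^bsub>order_R a b c\<^esub> y) =
        R_to_K\<^sub>0 a b c x \<oplus>\<^bsub>alg_K\<^sub>0 a b c\<^esub> R_to_K\<^sub>0 a b c y"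
      by (simp only: xy Za Qa R_to_K\<^sub>0_coset map_poly_rat_add)
  next
    fix x assume "x \<in> carrier (order_R a b c)"
    then show "R_to_K\<^sub>0 a b c x \<in> carrier (alg_K\<^sub>0 a b c)"
      unfolding carrier_order_R carrier_alg_K\<^sub>0 by (auto simp: R_to_K\<^sub>0_coset)
  next
    show "R_to_K\<^sub>0 a b c \<one>\<^bsub>order_R a b c\<^esub> = \<one>\<^bsub>alg_K\<^sub>0 a b c\<^esub>"
      by (simp only: ones R_to_K\<^sub>0_coset) simp
  qed
qed

lemma dvd_map_poly_rat:
  fixes p q :: "int poly"
  assumes lc: "lead_coeff p = 1" and dvd: "map_poly rat_of_int p dvd map_poly rat_of_int q"
  shows "p dvd q"
proof -
  have p0: "p \<noteq> 0" using lc by auto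
  obtain s r where sr: "pseudo_divmod q p = (s, r)" by fastforce
  from pseudo_divmod[OF p0 sr] lc have q: "q = p * s + r" and r: "r = 0 \<or> degree r < degree p"
    by simp_all
  have deg: "degree (map_poly rat_of_int t) = degree t" for t :: "int poly"
    by (rule degree_map_poly) simp
  have "map_poly rat_of_int p dvd map_poly rat_of_int r"
    using dvd unfolding q map_poly_rat_add map_poly_rat_mult
    by (metis dvd_add_right_iff dvd_triv_left)
  then have "map_poly rat_of_int r = 0"
    using r deg by (metis dvd_imp_degree_le leD map_poly_0)
  then have "r = 0" by (simp add: poly_eq_iff coeff_map_poly)
  then show ?thesis unfolding q by simp
qed

lemma inj_on_R_to_K\<^sub>0: "inj_on (R_to_K\<^sub>0 a b c) (carrier (order_R a b c))"
proof -
  have lc: "lead_coeff (chi a b c :: int poly) = 1"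
    unfolding chi_def by (simp add: lead_coeff_mult)
  show ?thesis
    unfolding carrier_order_R
  proof (rule inj_onI, elim imageE, simp only: R_to_K\<^sub>0_coset)
    fix p q :: "int poly"
    assume "PIdl\<^bsub>polys\<^esub> (chi a b c) +>\<^bsub>polys\<^esub> map_poly rat_of_int p =
      PIdl\<^bsub>polys\<^esub> (chi a b c) +>\<^bsub>polys\<^esub> map_poly rat_of_int q"
    then have "map_poly rat_of_int (chi a b c) dvd map_poly rat_of_int (p - q)"
      unfolding coset_eq_iff map_poly_chi map_poly_rat_diff .
    from dvd_map_poly_rat[OF lc this]
    show "PIdl\<^bsub>polys\<^esub> (chi a b c) +>\<^bsub>polys\<^esub> p = PIdl\<^bsub>polys\<^esub> (chi a b c) +>\<^bsub>polys\<^esub> q"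
      unfolding coset_eq_iff .
  qed
qed

lemma mod_K\<^sub>0_simps:
  "carrier (mod_K\<^sub>0 a b c) = carrier (alg_K\<^sub>0 a b c)"
  "ring.add (mod_K\<^sub>0 a b c) = ring.add (alg_K\<^sub>0 a b c)"
  "ring.zero (mod_K\<^sub>0 a b c) = ring.zero (alg_K\<^sub>0 a b c)"
  "r \<odot>\<^bsub>mod_K\<^sub>0 a b c\<^esub> x = R_to_K\<^sub>0 a b c r \<otimes>\<^bsub>alg_K\<^sub>0 a b c\<^esub> x"
  by (simp_all add: mod_K\<^sub>0_def ring.defs)

lemma module_mod_K\<^sub>0: "module (order_R a b c) (mod_K\<^sub>0 a b c)"
proof -
  interpret R: cring "order_R a b c" by (rule cring_order_R)
  interpret K: cring "alg_K\<^sub>0 a b c" by (rule cring_alg_K\<^sub>0)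
  have "abelian_group (mod_K\<^sub>0 a b c)"
    by (rule abelian_groupI; unfold mod_K\<^sub>0_simps)
      (simp_all add: K.a_ac K.add.l_inv_ex)
  then show ?thesis
    by (intro moduleI cring_order_R)
      (simp_all add: mod_K\<^sub>0_simps ring_hom_closed[OF R_to_K\<^sub>0_hom] ring_hom_add[OF R_to_K\<^sub>0_hom]
        ring_hom_mult[OF R_to_K\<^sub>0_hom] ring_hom_one[OF R_to_K\<^sub>0_hom] K.l_distr K.r_distr K.m_assoc)
qed

definition fractional_ideal :: "int \<Rightarrow> int \<Rightarrow> int \<Rightarrow> rat poly set set \<Rightarrow> bool"
  where "fractional_ideal a b c I \<longleftrightarrow>
    submodule I (order_R a b c) (mod_K\<^sub>0 a b c) \<and>
    add_monoid (alg_K\<^sub>0 a b c)\<lparr>carrier := I\<rparr> \<cong> free_Abelian_group {..<3::nat}"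

lemma fractional_ideal_iff:
  "fractional_ideal a b c I \<longleftrightarrow>
    subgroup I (add_monoid (alg_K\<^sub>0 a b c)) \<and>
    (\<forall>r\<in>carrier (order_R a b c). \<forall>x\<in>I. R_to_K\<^sub>0 a b c r \<otimes>\<^bsub>alg_K\<^sub>0 a b c\<^esub> x \<in> I) \<and>
    add_monoid (alg_K\<^sub>0 a b c)\<lparr>carrier := I\<rparr> \<cong> free_Abelian_group {..<3::nat}"
proof -
  have "subgroup I (add_monoid (mod_K\<^sub>0 a b c)) \<longleftrightarrow> subgroup I (add_monoid (alg_K\<^sub>0 a b c))"
    by (simp add: subgroup_def m_inv_def mod_K\<^sub>0_simps)
  then show ?thesis
    unfolding fractional_ideal_def submodule_def submodule_axioms_def mod_K\<^sub>0_simps by blast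
qed

lemma fractional_ideal_subset: "fractional_ideal a b c I \<Longrightarrow> I \<subseteq> carrier (alg_K\<^sub>0 a b c)"
  unfolding fractional_ideal_iff using subgroup.subset by fastforce

lemma l_coset_image: "k <#\<^bsub>G\<^esub> I = (\<lambda>x. k \<otimes>\<^bsub>G\<^esub> x) ` I"
  by (auto simp: l_coset_def)

lemma fractional_ideal_l_coset:
  assumes I: "fractional_ideal a b c I" and k: "k \<in> Units (alg_K\<^sub>0 a b c)"
  shows "fractional_ideal a b c (k <#\<^bsub>alg_K\<^sub>0 a b c\<^esub> I)"
proof -
  interpret K: cring "alg_K\<^sub>0 a b c" by (rule cring_alg_K\<^sub>0)
  note IK = fractional_ideal_subset[OF I]
  have kK: "k \<in> carrier (alg_K\<^sub>0 a b c)" using k by blast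
  interpret h: group_hom "add_monoid (alg_K\<^sub>0 a b c)" "add_monoid (alg_K\<^sub>0 a b c)"
    "\<lambda>x. k \<otimes>\<^bsub>alg_K\<^sub>0 a b c\<^esub> x"
    by (intro group_hom.intro group_hom_axioms.intro K.a_group) (auto simp: hom_def kK K.r_distr)
  have sub: "subgroup (k <#\<^bsub>alg_K\<^sub>0 a b c\<^esub> I) (add_monoid (alg_K\<^sub>0 a b c))"
    unfolding l_coset_image
    by (rule h.subgroup_img_is_subgroup) (use I in \<open>simp add: fractional_ideal_iff\<close>)
  have smul: "R_to_K\<^sub>0 a b c r \<otimes>\<^bsub>alg_K\<^sub>0 a b c\<^esub> x \<in> k <#\<^bsub>alg_K\<^sub>0 a b c\<^esub> I"
    if r: "r \<in> carrier (order_R a b c)" and x: "x \<in> k <#\<^bsub>alg_K\<^sub>0 a b c\<^esub> I" for r x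
  proof -
    from x obtain y where y: "y \<in> I" "x = k \<otimes>\<^bsub>alg_K\<^sub>0 a b c\<^esub> y"
      unfolding l_coset_image by blast
    have "R_to_K\<^sub>0 a b c r \<otimes>\<^bsub>alg_K\<^sub>0 a b c\<^esub> x =
        k \<otimes>\<^bsub>alg_K\<^sub>0 a b c\<^esub> (R_to_K\<^sub>0 a b c r \<otimes>\<^bsub>alg_K\<^sub>0 a b c\<^esub> y)"
      unfolding y(2) using subsetD[OF IK y(1)] kK ring_hom_closed[OF R_to_K\<^sub>0_hom r]
      by (intro K.m_lcomm)
    moreover have "R_to_K\<^sub>0 a b c r \<otimes>\<^bsub>alg_K\<^sub>0 a b c\<^esub> y \<in> I"
      using I r y(1) unfolding fractional_ideal_iff by blast
    ultimately show ?thesis unfolding l_coset_image by blast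
  qed
  have "(\<lambda>x. k \<otimes>\<^bsub>alg_K\<^sub>0 a b c\<^esub> x) \<in>
      iso (add_monoid (alg_K\<^sub>0 a b c)\<lparr>carrier := I\<rparr>)
          (add_monoid (alg_K\<^sub>0 a b c)\<lparr>carrier := k <#\<^bsub>alg_K\<^sub>0 a b c\<^esub> I\<rparr>)"
  proof -
    have "inj_on (\<lambda>x. k \<otimes>\<^bsub>alg_K\<^sub>0 a b c\<^esub> x) I"
      using K.Units_l_cancel[OF k] by (intro inj_onI) (simp add: subsetD[OF IK])
    then show ?thesis
      using kK by (simp add: iso_def hom_def bij_betw_def l_coset_image Pi_iff K.r_distr
          subsetD[OF IK])
  qed
  moreover have "group (add_monoid (alg_K\<^sub>0 a b c)\<lparr>carrier := I\<rparr>)"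
    using I subgroup.subgroup_is_group[OF _ K.a_group] unfolding fractional_ideal_iff by blast
  ultimately have "add_monoid (alg_K\<^sub>0 a b c)\<lparr>carrier := k <#\<^bsub>alg_K\<^sub>0 a b c\<^esub> I\<rparr> \<cong>
      add_monoid (alg_K\<^sub>0 a b c)\<lparr>carrier := I\<rparr>"
    by (metis group.iso_sym is_isoI)
  then have "add_monoid (alg_K\<^sub>0 a b c)\<lparr>carrier := k <#\<^bsub>alg_K\<^sub>0 a b c\<^esub> I\<rparr> \<cong>
      free_Abelian_group {..<3::nat}"
    by (rule iso_trans) (use I in \<open>simp add: fractional_ideal_iff\<close>)
  with sub smul show ?thesis unfolding fractional_ideal_iff by blast
qed

text \<open>
  Fractional ideals are multiplied by \<open>ideal_prod\<close>, which for arbitrary subsets of a ring is the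
  set of finite (nonempty) sums of products.
\<close>

definition invertible_ideal :: "int \<Rightarrow> int \<Rightarrow> int \<Rightarrow> rat poly set set \<Rightarrow> bool"
  where "invertible_ideal a b c I \<longleftrightarrow>
    fractional_ideal a b c I \<and>
    (\<exists>J. fractional_ideal a b c J \<and>
         ideal_prod (alg_K\<^sub>0 a b c) I J = R_to_K\<^sub>0 a b c ` carrier (order_R a b c))"

definition ideal_equiv :: "int \<Rightarrow> int \<Rightarrow> int \<Rightarrow> (rat poly set set \<times> rat poly set set) set"
  where "ideal_equiv a b c =
    {(I, J). fractional_ideal a b c I \<and> fractional_ideal a b c J \<and>
             (\<exists>k\<in>Units (alg_K\<^sub>0 a b c). I = k <#\<^bsub>alg_K\<^sub>0 a b c\<^esub> J)}"

lemma l_coset_l_coset: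
  assumes "I \<subseteq> carrier (alg_K\<^sub>0 a b c)" "k \<in> Units (alg_K\<^sub>0 a b c)" "l \<in> Units (alg_K\<^sub>0 a b c)"
  shows "k <#\<^bsub>alg_K\<^sub>0 a b c\<^esub> (l <#\<^bsub>alg_K\<^sub>0 a b c\<^esub> I) = (k \<otimes>\<^bsub>alg_K\<^sub>0 a b c\<^esub> l) <#\<^bsub>alg_K\<^sub>0 a b c\<^esub> I"
proof -
  interpret K: cring "alg_K\<^sub>0 a b c" by (rule cring_alg_K\<^sub>0)
  show ?thesis
    unfolding l_coset_image image_image
  proof (intro image_cong refl)
    fix x assume "x \<in> I"
    with assms(1) have "x \<in> carrier (alg_K\<^sub>0 a b c)" by (rule subsetD)
    with assms(2,3) show "k \<otimes>\<^bsub>alg_K\<^sub>0 a b c\<^esub> (l \<otimes>\<^bsub>alg_K\<^sub>0 a b c\<^esub> x) =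
        k \<otimes>\<^bsub>alg_K\<^sub>0 a b c\<^esub> l \<otimes>\<^bsub>alg_K\<^sub>0 a b c\<^esub> x"
      by (simp add: K.m_assoc K.Units_closed)
  qed
qed

lemma one_l_coset:
  assumes "I \<subseteq> carrier (alg_K\<^sub>0 a b c)"
  shows "\<one>\<^bsub>alg_K\<^sub>0 a b c\<^esub> <#\<^bsub>alg_K\<^sub>0 a b c\<^esub> I = I"
proof -
  interpret K: cring "alg_K\<^sub>0 a b c" by (rule cring_alg_K\<^sub>0)
  have "(\<lambda>x. \<one>\<^bsub>alg_K\<^sub>0 a b c\<^esub> \<otimes>\<^bsub>alg_K\<^sub>0 a b c\<^esub> x) ` I = (\<lambda>x. x) ` I"
    using assms by (intro image_cong refl) auto
  then show ?thesis unfolding l_coset_image by simp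
qed

lemma equiv_ideal_equiv: "equiv {I. fractional_ideal a b c I} (ideal_equiv a b c)"
proof -
  interpret K: cring "alg_K\<^sub>0 a b c" by (rule cring_alg_K\<^sub>0)
  show ?thesis
  proof (rule equivI)
    show "ideal_equiv a b c \<subseteq> {I. fractional_ideal a b c I} \<times> {I. fractional_ideal a b c I}"
      by (auto simp: ideal_equiv_def)
    show "refl_on {I. fractional_ideal a b c I} (ideal_equiv a b c)"
      by (auto simp: refl_on_def ideal_equiv_def
          intro!: bexI[OF _ K.Units_one_closed] one_l_coset[symmetric] fractional_ideal_subset)
    show "sym (ideal_equiv a b c)"
    proof (rule symI)
      fix I J assume "(I, J) \<in> ideal_equiv a b c"
      then obtain k where IJ: "fractional_ideal a b c I" "fractional_ideal a b c J"
        and k: "k \<in> Units (alg_K\<^sub>0 a b c)" "I = k <#\<^bsub>alg_K\<^sub>0 a b c\<^esub> J"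
        unfolding ideal_equiv_def by blast
      have "J = inv\<^bsub>alg_K\<^sub>0 a b c\<^esub> k <#\<^bsub>alg_K\<^sub>0 a b c\<^esub> I"
        using k IJ by (simp add: l_coset_l_coset fractional_ideal_subset one_l_coset)
      then show "(J, I) \<in> ideal_equiv a b c"
        unfolding ideal_equiv_def using IJ k(1) by blast
    qed
    show "trans (ideal_equiv a b c)"
    proof (rule transI)
      fix I J L assume "(I, J) \<in> ideal_equiv a b c" "(J, L) \<in> ideal_equiv a b c"
      then obtain k l where IL: "fractional_ideal a b c I" "fractional_ideal a b c L"
        and k: "k \<in> Units (alg_K\<^sub>0 a b c)" "I = k <#\<^bsub>alg_K\<^sub>0 a b c\<^esub> J"
        and l: "l \<in> Units (alg_K\<^sub>0 a b c)" "J = l <#\<^bsub>alg_K\<^sub>0 a b c\<^esub> L"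
        unfolding ideal_equiv_def by blast
      have "I = (k \<otimes>\<^bsub>alg_K\<^sub>0 a b c\<^esub> l) <#\<^bsub>alg_K\<^sub>0 a b c\<^esub> L"
        using k l IL by (simp add: l_coset_l_coset fractional_ideal_subset)
      then show "(I, L) \<in> ideal_equiv a b c"
        unfolding ideal_equiv_def using IL k(1) l(1) by blast
    qed
  qed
qed

lemma ideal_prod_l_coset:
  assumes I: "I \<subseteq> carrier (alg_K\<^sub>0 a b c)" and J: "J \<subseteq> carrier (alg_K\<^sub>0 a b c)"
    and k: "k \<in> carrier (alg_K\<^sub>0 a b c)" and l: "l \<in> carrier (alg_K\<^sub>0 a b c)"
  shows "ideal_prod (alg_K\<^sub>0 a b c) (k <#\<^bsub>alg_K\<^sub>0 a b c\<^esub> I) (l <#\<^bsub>alg_K\<^sub>0 a b c\<^esub> J) =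
    (k \<otimes>\<^bsub>alg_K\<^sub>0 a b c\<^esub> l) <#\<^bsub>alg_K\<^sub>0 a b c\<^esub> ideal_prod (alg_K\<^sub>0 a b c) I J" (is "?L = ?R")
proof -
  interpret K: cring "alg_K\<^sub>0 a b c" by (rule cring_alg_K\<^sub>0)
  have closed: "s \<in> carrier (alg_K\<^sub>0 a b c)" if "s \<in> ideal_prod (alg_K\<^sub>0 a b c) I J" for s
    using that by induction (use I J in auto)
  have eq: "(k \<otimes>\<^bsub>alg_K\<^sub>0 a b c\<^esub> i) \<otimes>\<^bsub>alg_K\<^sub>0 a b c\<^esub> (l \<otimes>\<^bsub>alg_K\<^sub>0 a b c\<^esub> j) =
      (k \<otimes>\<^bsub>alg_K\<^sub>0 a b c\<^esub> l) \<otimes>\<^bsub>alg_K\<^sub>0 a b c\<^esub> (i \<otimes>\<^bsub>alg_K\<^sub>0 a b c\<^esub> j)" if "i \<in> I" "j \<in> J" for i j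
    using subsetD[OF I that(1)] subsetD[OF J that(2)] k l by (simp add: K.m_ac)
  show ?thesis
  proof
    show "?L \<subseteq> ?R"
    proof
      fix x assume "x \<in> ?L"
      then show "x \<in> ?R"
      proof induction
        case (prod i j)
        then show ?case
          unfolding l_coset_image by (auto simp: eq intro: ideal_prod.prod)
      next
        case (sum s1 s2)
        then obtain t1 t2 where t: "t1 \<in> ideal_prod (alg_K\<^sub>0 a b c) I J"
          "t2 \<in> ideal_prod (alg_K\<^sub>0 a b c) I J"
          "s1 = (k \<otimes>\<^bsub>alg_K\<^sub>0 a b c\<^esub> l) \<otimes>\<^bsub>alg_K\<^sub>0 a b c\<^esub> t1"
          "s2 = (k \<otimes>\<^bsub>alg_K\<^sub>0 a b c\<^esub> l) \<otimes>\<^bsub>alg_K\<^sub>0 a b c\<^esub> t2"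
          unfolding l_coset_image by blast
        have "s1 \<oplus>\<^bsub>alg_K\<^sub>0 a b c\<^esub> s2 =
            (k \<otimes>\<^bsub>alg_K\<^sub>0 a b c\<^esub> l) \<otimes>\<^bsub>alg_K\<^sub>0 a b c\<^esub> (t1 \<oplus>\<^bsub>alg_K\<^sub>0 a b c\<^esub> t2)"
          using t k l closed by (simp add: K.r_distr)
        then show ?case
          using ideal_prod.sum[OF t(1,2)] unfolding l_coset_image by blast
      qed
    qed
  next
    have "(k \<otimes>\<^bsub>alg_K\<^sub>0 a b c\<^esub> l) \<otimes>\<^bsub>alg_K\<^sub>0 a b c\<^esub> s \<in> ?L"
      if "s \<in> ideal_prod (alg_K\<^sub>0 a b c) I J" for s
      using that
    proof induction
      case (prod i j)
      then show ?case
        unfolding eq[OF prod, symmetric] l_coset_image by (blast intro: ideal_prod.prod)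
    next
      case (sum s1 s2)
      then show ?case
        using k l closed by (simp add: K.r_distr ideal_prod.sum)
    qed
    then show "?R \<subseteq> ?L" unfolding l_coset_image[of _ "k \<otimes>\<^bsub>alg_K\<^sub>0 a b c\<^esub> l"] by blast
  qed
qed

text \<open>
  The product of two classes is given by representatives; the union does not depend on them
  (lemma \<open>ICM_mult_class\<close> below).
\<close>

definition ICM :: "int \<Rightarrow> int \<Rightarrow> int \<Rightarrow> rat poly set set set monoid"
  where "ICM a b c =
    \<lparr>carrier = {I. fractional_ideal a b c I} // ideal_equiv a b c,
     monoid.mult = \<lambda>C D. \<Union>I\<in>C. \<Union>J\<in>D. ideal_equiv a b c `` {ideal_prod (alg_K\<^sub>0 a b c) I J},
     one = ideal_equiv a b c `` {R_to_K\<^sub>0 a b c ` carrier (order_R a b c)}\<rparr>"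

lemma ICM_mult_class:
  assumes I: "fractional_ideal a b c I" and J: "fractional_ideal a b c J"
  shows "ideal_equiv a b c `` {I} \<otimes>\<^bsub>ICM a b c\<^esub> ideal_equiv a b c `` {J} =
    ideal_equiv a b c `` {ideal_prod (alg_K\<^sub>0 a b c) I J}"
proof -
  interpret K: cring "alg_K\<^sub>0 a b c" by (rule cring_alg_K\<^sub>0)
  note eqv = equiv_ideal_equiv[of a b c]
  have scale: "ideal_equiv a b c `` {k <#\<^bsub>alg_K\<^sub>0 a b c\<^esub> P} = ideal_equiv a b c `` {P}"
    if P: "P \<subseteq> carrier (alg_K\<^sub>0 a b c)" and k: "k \<in> Units (alg_K\<^sub>0 a b c)" for P k
  proof (cases "fractional_ideal a b c P")
    case True
    then have "(k <#\<^bsub>alg_K\<^sub>0 a b c\<^esub> P, P) \<in> ideal_equiv a b c"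
      unfolding ideal_equiv_def using fractional_ideal_l_coset k by blast
    then show ?thesis by (rule equiv_class_eq[OF eqv])
  next
    case False
    have "P = inv\<^bsub>alg_K\<^sub>0 a b c\<^esub> k <#\<^bsub>alg_K\<^sub>0 a b c\<^esub> (k <#\<^bsub>alg_K\<^sub>0 a b c\<^esub> P)"
      using k P by (simp add: l_coset_l_coset one_l_coset)
    with False have "\<not> fractional_ideal a b c (k <#\<^bsub>alg_K\<^sub>0 a b c\<^esub> P)"
      using fractional_ideal_l_coset[OF _ K.Units_inv_Units[OF k]] by metis
    with False show ?thesis by (auto simp: ideal_equiv_def)
  qed
  have sub: "ideal_prod (alg_K\<^sub>0 a b c) I J \<subseteq> carrier (alg_K\<^sub>0 a b c)"
  proof
    fix s assume "s \<in> ideal_prod (alg_K\<^sub>0 a b c) I J"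
    then show "s \<in> carrier (alg_K\<^sub>0 a b c)"
      by induction (use fractional_ideal_subset[OF I] fractional_ideal_subset[OF J] in auto)
  qed
  have const: "ideal_equiv a b c `` {ideal_prod (alg_K\<^sub>0 a b c) I' J'} =
      ideal_equiv a b c `` {ideal_prod (alg_K\<^sub>0 a b c) I J}"
    if I': "I' \<in> ideal_equiv a b c `` {I}" and J': "J' \<in> ideal_equiv a b c `` {J}" for I' J'
  proof -
    have "(I', I) \<in> ideal_equiv a b c" "(J', J) \<in> ideal_equiv a b c"
      using I' J' eqv by (auto simp: equiv_def dest: symD)
    then obtain k l where k: "k \<in> Units (alg_K\<^sub>0 a b c)" "I' = k <#\<^bsub>alg_K\<^sub>0 a b c\<^esub> I"
      and l: "l \<in> Units (alg_K\<^sub>0 a b c)" "J' = l <#\<^bsub>alg_K\<^sub>0 a b c\<^esub> J"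
      unfolding ideal_equiv_def by blast
    show ?thesis
      unfolding k(2) l(2)
      using k(1) l(1) scale[OF sub, of "k \<otimes>\<^bsub>alg_K\<^sub>0 a b c\<^esub> l"]
      by (subst ideal_prod_l_coset[OF fractional_ideal_subset[OF I] fractional_ideal_subset[OF J]])
        (simp_all add: K.Units_closed)
  qed
  have "I \<in> ideal_equiv a b c `` {I}" "J \<in> ideal_equiv a b c `` {J}"
    using equiv_class_self[OF eqv] I J by auto
  then have ne: "ideal_equiv a b c `` {I} \<noteq> {}" "ideal_equiv a b c `` {J} \<noteq> {}" by blast+
  have "(\<Union>I'\<in>ideal_equiv a b c `` {I}. \<Union>J'\<in>ideal_equiv a b c `` {J}.
      ideal_equiv a b c `` {ideal_prod (alg_K\<^sub>0 a b c) I' J'}) =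
    (\<Union>I'\<in>ideal_equiv a b c `` {I}. \<Union>J'\<in>ideal_equiv a b c `` {J}.
      ideal_equiv a b c `` {ideal_prod (alg_K\<^sub>0 a b c) I J})"
    by (intro SUP_cong refl const)
  also have "\<dots> = ideal_equiv a b c `` {ideal_prod (alg_K\<^sub>0 a b c) I J}"
    using ne by (simp only: UN_constant if_False)
  finally show ?thesis unfolding ICM_def by simp
qed

definition Cl :: "int \<Rightarrow> int \<Rightarrow> int \<Rightarrow> rat poly set set set monoid"
  where "Cl a b c =
    (ICM a b c)\<lparr>carrier := {I. invertible_ideal a b c I} // ideal_equiv a b c\<rparr>"

definition grp_G :: "int \<Rightarrow> int \<Rightarrow> int \<Rightarrow> (int \<times> int) monoid"
  where "grp_G a b c =
    units_of (residue_ring ((b - a) * (c - a))) \<times>\<times> units_of (residue_ring ((c - b) * (c - a)))"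

text \<open>
  \<open>residue_ring m\<close> has the carrier \<open>{0..m - 1}\<close>, so \<open>u mod m\<close> is the residue class of \<open>u\<close>.
\<close>

definition residue_pair :: "int \<Rightarrow> int \<Rightarrow> int \<Rightarrow> int \<Rightarrow> int \<Rightarrow> int \<times> int"
  where "residue_pair a b c u v = (u mod ((b - a) * (c - a)), v mod ((c - b) * (c - a)))"

definition sub_H :: "int \<Rightarrow> int \<Rightarrow> int \<Rightarrow> (int \<times> int) set"
  where "sub_H a b c =
    {residue_pair a b c 1 1, residue_pair a b c 1 (- 1),
     residue_pair a b c (- 1) 1, residue_pair a b c (- 1) (- 1)}"

text \<open>Both divisions below are exact by the preceding divisibility conditions.\<close>

definition sub_K :: "int \<Rightarrow> int \<Rightarrow> int \<Rightarrow> (int \<times> int) set"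
  where "sub_K a b c =
    {residue_pair a b c u v | u v.
       residue_pair a b c u v \<in> carrier (grp_G a b c) \<and>
       b - a dvd u - 1 \<and> c - b dvd v - 1 \<and>
       c - a dvd (u * (v - 1)) div (c - b) - (u - 1) div (b - a)}"

definition internal_direct_product ::
    "('a, 'm) monoid_scheme \<Rightarrow> 'a set \<Rightarrow> 'a set \<Rightarrow> 'a set \<Rightarrow> bool"
  where "internal_direct_product G N H K \<longleftrightarrow>
    N = H <#>\<^bsub>G\<^esub> K \<and> H \<inter> K = {\<one>\<^bsub>G\<^esub>} \<and>
    H \<lhd> G\<lparr>carrier := N\<rparr> \<and> K \<lhd> G\<lparr>carrier := N\<rparr>"

end

theory Submission
  imports Defs
begin

text \<open>
  Put \<open>p = b - a\<close>, \<open>q = c - b\<close>, \<open>r = c - a = p + q\<close>. Evaluating polynomials at the three roots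
  turns \<open>\<rat>[x]/(\<chi>)\<close> into the algebra \<open>\<rat>\<^sup>3\<close> with coordinatewise operations (\<open>\<tau>\<close> is the inverse,
  given by Lagrange interpolation), and \<open>R\<close> into an order of finite index in the maximal order \<open>\<int>\<^sup>3\<close>.
  Newton interpolation at \<open>b, a, c\<close> describes this order by congruences: it consists of the \<open>(x, y, z)\<close>
  such that, for some integer \<open>j\<close>, \<open>x \<equiv> y - p j\<close> modulo \<open>p r\<close> and \<open>z \<equiv> y + q j\<close> modulo \<open>q r\<close>. Its
  conductor is \<open>p r \<int> \<times> p q \<int> \<times> q r \<int>\<close>.

  The maximal order is a product of principal ideal domains, so the class group of \<open>R\<close> is the group of
  residues of \<open>\<int>\<^sup>3\<close> prime to the conductor, modulo those coming from \<open>R\<close> and from the units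
  \<open>(\<plusminus>1, \<plusminus>1, \<plusminus>1)\<close> of \<open>\<int>\<^sup>3\<close>. Scalars lie in \<open>R\<close>, so the middle coordinate may be normalised to \<open>1\<close>;
  what remains is a pair \<open>(u, v)\<close> of residues modulo \<open>p r\<close> and \<open>q r\<close>, that is, an element of \<open>G\<close>. The
  ideal attached to it is \<open>M u v\<close>, which is \<open>(u, 1, 1/v) R\<close> plus the conductor. The sign group gives \<open>H\<close>
  and the residues coming from \<open>R\<close> give \<open>K\<close>.

  The proof makes this concrete without localisation. The ideals multiply like the pairs
  (\<open>span_prod_M\<close>), so \<open>(u, v) \<mapsto> [M u v]\<close> is a homomorphism from \<open>G\<close>.

  Surjectivity (\<open>carrier_Cl\<close>): an invertible ideal \<open>I\<close> can be scaled so that each of its three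
  coordinate projections is \<open>\<int>\<close> (\<open>primitive_scaling\<close>). Since \<open>1\<close> is a sum of products of elements of
  \<open>I\<close> and of its inverse, each prime \<open>l\<close> admits an element of \<open>I\<close> that is prime to \<open>l\<close> where \<open>l\<close>
  divides the conductor (\<open>local_unit_exists\<close>); these elements are combined by the Chinese remainder
  principle into a generator of \<open>I\<close> modulo the conductor, so that \<open>I\<close> contains some \<open>M u v\<close>.
  Equality follows from a rigidity principle (\<open>ideal_eq_R_if_one\<close>): an invertible ideal inside \<open>\<int>\<^sup>3\<close>
  that contains \<open>1\<close> is \<open>R\<close> itself.

  Kernel (\<open>kernel_class_map\<close>): if \<open>M u v = k R\<close> then \<open>k\<close> is a triple of signs
  (\<open>M_principal_iff\<close>), and by rigidity \<open>M u v = R\<close> iff \<open>1 \<in> M u v\<close>, which unfolds to the divisibility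
  conditions defining \<open>K\<close> (\<open>one_in_M_iff\<close>). Hence the kernel is \<open>H K\<close>. For \<open>r \<ge> 4\<close> no nontrivial pair of
  signs meets the conditions of \<open>K\<close>, so the product is direct. For \<open>r \<le> 3\<close> both moduli are among
  \<open>2, 3, 6\<close>, whose only unit residues are \<open>\<plusminus>1\<close>, so \<open>G = H\<close> and the class group is trivial.
\<close>

section \<open>The split algebra of rational triples\<close>

datatype triple = Triple (at_a: rat) (at_b: rat) (at_c: rat)

instantiation triple :: comm_ring_1
begin

definition "0 = Triple 0 0 0"
definition "1 = Triple 1 1 1"
definition "s + t = Triple (at_a s + at_a t) (at_b s + at_b t) (at_c s + at_c t)"
definition "s - t = Triple (at_a s - at_a t) (at_b s - at_b t) (at_c s - at_c t)"
definition "- t = Triple (- at_a t) (- at_b t) (- at_c t)"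
definition "s * t = Triple (at_a s * at_a t) (at_b s * at_b t) (at_c s * at_c t)"

instance
  by standard
    (simp_all add: zero_triple_def one_triple_def plus_triple_def minus_triple_def
      uminus_triple_def times_triple_def algebra_simps)

end

lemma triple_simps [simp]:
  "Triple x y z + Triple x' y' z' = Triple (x + x') (y + y') (z + z')"
  "Triple x y z - Triple x' y' z' = Triple (x - x') (y - y') (z - z')"
  "Triple x y z * Triple x' y' z' = Triple (x * x') (y * y') (z * z')"
  "- Triple x y z = Triple (- x) (- y) (- z)"
  by (simp_all add: plus_triple_def minus_triple_def uminus_triple_def times_triple_def)

abbreviation triples :: "triple ring"
  where "triples \<equiv> ring_of_type_algebra"

abbreviation span_prod :: "triple set \<Rightarrow> triple set \<Rightarrow> triple set"  (infixl \<open>\<star>\<close> 80)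
  where "A \<star> B \<equiv> ideal_prod triples A B"

lemma span_prod_mult: "s \<in> A \<Longrightarrow> t \<in> B \<Longrightarrow> s * t \<in> A \<star> B"
  using ideal_prod.prod[of s A t B triples] by (simp add: ring_of_type_algebra_def)

lemma span_prod_add: "s \<in> A \<star> B \<Longrightarrow> t \<in> A \<star> B \<Longrightarrow> s + t \<in> A \<star> B"
  using ideal_prod.sum[of s triples A B t] by (simp add: ring_of_type_algebra_def)

lemma span_prod_induct [consumes 1, case_names mult add]:
  assumes "x \<in> A \<star> B"
    and "\<And>s t. s \<in> A \<Longrightarrow> t \<in> B \<Longrightarrow> P (s * t)"
    and "\<And>s t. s \<in> A \<star> B \<Longrightarrow> P s \<Longrightarrow> t \<in> A \<star> B \<Longrightarrow> P t \<Longrightarrow> P (s + t)"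
  shows "P x"
  using assms(1) by induction (use assms(2,3) in \<open>auto simp: ring_of_type_algebra_def\<close>)

lemma span_prod_subsetI:
  assumes "\<And>s t. s \<in> A \<Longrightarrow> t \<in> B \<Longrightarrow> s * t \<in> C"
    and "\<And>s t. s \<in> C \<Longrightarrow> t \<in> C \<Longrightarrow> s + t \<in> C"
  shows "A \<star> B \<subseteq> C"
proof
  fix x assume "x \<in> A \<star> B"
  then show "x \<in> C" by (induction rule: span_prod_induct) (use assms in auto)
qed

lemma span_prod_commute: "A \<star> B = B \<star> A"
proof -
  have "A \<star> B \<subseteq> B \<star> A" for A B
    by (rule span_prod_subsetI) (metis mult.commute span_prod_mult, rule span_prod_add)
  then show ?thesis by blast
qed

lemma span_prod_mult_left:
  assumes "s \<in> A" "x \<in> B \<star> C"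
  shows "s * x \<in> (A \<star> B) \<star> C"
  using assms(2)
proof (induction rule: span_prod_induct)
  case (mult t u)
  then show ?case
    using span_prod_mult[OF span_prod_mult[OF assms(1) mult(1)] mult(2)] by (simp add: mult.assoc)
next
  case (add t u)
  then show ?case by (simp add: distrib_left span_prod_add)
qed

lemma span_prod_assoc: "(A \<star> B) \<star> C = A \<star> (B \<star> C)"
proof -
  have sub: "A \<star> (B \<star> C) \<subseteq> (A \<star> B) \<star> C" for A B C
    by (rule span_prod_subsetI[OF span_prod_mult_left span_prod_add])
  have "(A \<star> B) \<star> C = C \<star> (B \<star> A)" by (metis span_prod_commute)
  also have "\<dots> \<subseteq> (C \<star> B) \<star> A" by (rule sub)
  also have "\<dots> = A \<star> (B \<star> C)" by (metis span_prod_commute)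
  finally show ?thesis using sub by blast
qed

lemma span_prod_left_commute: "A \<star> (B \<star> C) = B \<star> (A \<star> C)"
  using span_prod_assoc span_prod_commute by metis

lemmas span_prod_ac = span_prod_assoc span_prod_commute span_prod_left_commute

lemma span_prod_scale: "(\<lambda>s. k * s) ` A \<star> B = (\<lambda>s. k * s) ` (A \<star> B)"
proof
  show "(\<lambda>s. k * s) ` A \<star> B \<subseteq> (\<lambda>s. k * s) ` (A \<star> B)"
  proof (rule span_prod_subsetI)
    fix s t assume "s \<in> (\<lambda>s. k * s) ` A" "t \<in> B"
    then show "s * t \<in> (\<lambda>s. k * s) ` (A \<star> B)"
      by (auto simp: mult.assoc intro!: imageI span_prod_mult)
  next
    fix s t assume "s \<in> (\<lambda>s. k * s) ` (A \<star> B)" "t \<in> (\<lambda>s. k * s) ` (A \<star> B)"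
    then show "s + t \<in> (\<lambda>s. k * s) ` (A \<star> B)"
      by (auto simp flip: distrib_left intro!: imageI span_prod_add)
  qed
  have "k * x \<in> (\<lambda>s. k * s) ` A \<star> B" if "x \<in> A \<star> B" for x
    using that
  proof (induction rule: span_prod_induct)
    case (mult s t)
    have "(k * s) * t \<in> (\<lambda>s. k * s) ` A \<star> B" using mult by (intro span_prod_mult) auto
    then show ?case by (simp add: mult.assoc)
  next
    case (add s t)
    then show ?case by (simp add: distrib_left span_prod_add)
  qed
  then show "(\<lambda>s. k * s) ` (A \<star> B) \<subseteq> (\<lambda>s. k * s) ` A \<star> B" by blast
qed

definition int_triple :: "int \<Rightarrow> int \<Rightarrow> int \<Rightarrow> triple"
  where "int_triple x y z = Triple (of_int x) (of_int y) (of_int z)"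

lemma int_triple_simps [simp]:
  "int_triple x y z = int_triple x' y' z' \<longleftrightarrow> x = x' \<and> y = y' \<and> z = z'"
  "int_triple x y z + int_triple x' y' z' = int_triple (x + x') (y + y') (z + z')"
  "int_triple x y z - int_triple x' y' z' = int_triple (x - x') (y - y') (z - z')"
  "int_triple x y z * int_triple x' y' z' = int_triple (x * x') (y * y') (z * z')"
  "- int_triple x y z = int_triple (- x) (- y) (- z)"
  by (simp_all add: int_triple_def)

lemma coordinate_simps [simp]:
  "at_a (s + t) = at_a s + at_a t" "at_b (s + t) = at_b s + at_b t" "at_c (s + t) = at_c s + at_c t"
  "at_a (s * t) = at_a s * at_a t" "at_b (s * t) = at_b s * at_b t" "at_c (s * t) = at_c s * at_c t"
  "at_a 1 = 1" "at_b 1 = 1" "at_c 1 = 1"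
  "at_a (int_triple x y z) = of_int x" "at_b (int_triple x y z) = of_int y"
  "at_c (int_triple x y z) = of_int z"
  by (simp_all add: plus_triple_def times_triple_def one_triple_def int_triple_def)

lemma one_eq_int_triple: "1 = int_triple 1 1 1"
  by (simp add: int_triple_def one_triple_def)

section \<open>Residues and greatest common divisors of integers\<close>

lemma unit_inverse:
  fixes u m :: int
  assumes "coprime u m" obtains w where "m dvd u * w - 1" "coprime w m"
  using assms
proof -
  from assms obtain w where w: "[u * w = 1] (mod m)" by (auto simp: coprime_iff_invertible_int)
  then have "m dvd u * w - 1" by (simp add: cong_iff_dvd_diff)
  moreover have "coprime w m"
    using w by (auto simp: coprime_iff_invertible_int mult.commute)
  ultimately show thesis using that by blast
qed

lemma int_ideal_principal:
  fixes S :: "int set"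
  assumes add: "\<And>m n. m \<in> S \<Longrightarrow> n \<in> S \<Longrightarrow> m + n \<in> S" and mult: "\<And>m n. n \<in> S \<Longrightarrow> m * n \<in> S"
    and n0: "n0 \<in> S" "n0 \<noteq> 0"
  shows "\<exists>g\<in>S. g \<noteq> 0 \<and> (\<forall>n\<in>S. g dvd n)"
proof -
  define g where "g = (LEAST k :: nat. 0 < k \<and> int k \<in> S)"
  have "\<bar>n0\<bar> \<in> S" using mult[OF n0(1), of "sgn n0"] by (simp add: abs_sgn mult.commute)
  then have ex: "0 < nat \<bar>n0\<bar> \<and> int (nat \<bar>n0\<bar>) \<in> S" using n0(2) by simp
  have g: "0 < g" "int g \<in> S" unfolding g_def using LeastI[where P = "\<lambda>k. 0 < k \<and> int k \<in> S", OF ex] by auto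
  have "int g dvd n" if n: "n \<in> S" for n
  proof (rule ccontr)
    assume "\<not> int g dvd n"
    then have pos: "0 < n mod int g"
      using g(1) pos_mod_sign[of "int g" n] unfolding dvd_eq_mod_eq_0 by linarith
    have "n mod int g = n + (- (n div int g)) * int g" by (simp add: minus_div_mult_eq_mod)
    then have "n mod int g \<in> S" using add[OF n mult[OF g(2)]] by metis
    with pos have "0 < nat (n mod int g) \<and> int (nat (n mod int g)) \<in> S" by simp
    then have "g \<le> nat (n mod int g)"
      using Least_le[where P = "\<lambda>k. 0 < k \<and> int k \<in> S", folded g_def] by blast
    then show False using pos g(1) pos_mod_bound[of "int g" n] by linarith
  qed
  moreover have "int g \<noteq> 0" using g(1) by simp
  ultimately show ?thesis using g(2) by blast
qed

text \<open>
  The inverse of a residue modulo \<open>m\<close> can be represented by an integer prime to any further number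
  \<open>k\<close>: add \<open>m t\<close> to a given representative \<open>w\<close>, where \<open>t\<close> collects exactly the primes of \<open>k\<close> that do
  not divide \<open>w\<close>. Then each prime of \<open>k\<close> divides precisely one of the two summands.
\<close>

lemma coprime_inverse_lift:
  fixes y m k :: int
  assumes "coprime y m" "k \<noteq> 0"
  obtains n where "m dvd n * y - 1" "coprime n k"
proof -
  obtain w where w: "m dvd y * w - 1" "coprime w m" using unit_inverse[OF assms(1)] .
  \<comment> \<open>The primes of \<open>k\<close> that divide \<open>w\<close> do not divide \<open>m\<close>, as \<open>w\<close> is prime to \<open>m\<close>.\<close>
  define t where "t = \<Prod>{l \<in> prime_factors k. \<not> l dvd w}"
  have t_iff: "l dvd t \<longleftrightarrow> \<not> l dvd w" if l: "Factorial_Ring.prime l" "l dvd k" for l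
  proof -
    have "l dvd t \<longleftrightarrow> (\<exists>l'\<in>{l \<in> prime_factors k. \<not> l dvd w}. l dvd l')"
      unfolding t_def by (rule prime_dvd_prod_iff) (use l in auto)
    also have "\<dots> \<longleftrightarrow> \<not> l dvd w"
      using l assms(2) by (auto simp: in_prime_factors_iff dest: primes_dvd_imp_eq)
    finally show ?thesis .
  qed
  have "coprime (w + m * t) k"
  proof (rule ccontr)
    assume "\<not> coprime (w + m * t) k"
    then obtain d where d: "d dvd w + m * t" "d dvd k" "\<not> is_unit d" by (rule not_coprimeE)
    then have "d \<noteq> 0" using assms(2) by auto
    then obtain l where l: "Factorial_Ring.prime l" "l dvd d" using d(3) prime_divisor_exists by blast
    have "l dvd w + m * t" "l dvd k" using l d dvd_trans by blast+
    show False
    proof (cases "l dvd w")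
      case True
      then have "l dvd m * t" using \<open>l dvd w + m * t\<close> by (simp add: dvd_add_right_iff)
      then have "l dvd m" using t_iff[OF l(1) \<open>l dvd k\<close>] True l(1) by (auto dest: prime_dvd_multD)
      then show False
        using coprime_common_divisor[OF w(2) True] l(1) not_prime_unit by blast
    next
      case False
      then have "l dvd m * t" using t_iff[OF l(1) \<open>l dvd k\<close>] by simp
      then show False using False \<open>l dvd w + m * t\<close> by (simp add: dvd_add_left_iff)
    qed
  qed
  moreover have "m dvd (w + m * t) * y - 1"
  proof -
    have "(w + m * t) * y - 1 = (y * w - 1) + m * (t * y)" by (simp add: algebra_simps)
    also have "m dvd \<dots>" using w(1) by (rule dvd_add) simp
    finally show ?thesis .
  qed
  ultimately show thesis using that by blast
qed

lemma coprime_if_no_common_prime: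
  fixes m n :: int
  assumes "m \<noteq> 0" "\<And>l. Factorial_Ring.prime l \<Longrightarrow> l dvd m \<Longrightarrow> \<not> l dvd n"
  shows "coprime n m"
proof (rule ccontr)
  assume "\<not> coprime n m"
  then obtain d where d: "d dvd n" "d dvd m" "\<not> is_unit d" by (rule not_coprimeE)
  with assms(1) have "d \<noteq> 0" by auto
  then obtain l where "Factorial_Ring.prime l" "l dvd d" using d(3) prime_divisor_exists by blast
  with d assms(2) show False using dvd_trans by blast
qed

abbreviation is_sign :: "int \<Rightarrow> bool"
  where "is_sign e \<equiv> e = 1 \<or> e = - 1"

text \<open>
  The unit groups modulo \<open>2\<close>, \<open>3\<close> and \<open>6\<close> consist of signs.
\<close>

lemma sign_residue:
  fixes u m :: int
  assumes "m = 2 \<or> m = 3 \<or> m = 6" and u: "coprime u m"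
  obtains e where "is_sign e" "m dvd e * u - 1"
proof -
  have u2: "\<not> 2 dvd u" if "2 dvd m" using coprime_common_divisor[OF u _ that] by auto
  have u3: "\<not> 3 dvd u" if "3 dvd m" using coprime_common_divisor[OF u _ that] by auto
  have "m dvd u - 1 \<or> m dvd - u - 1"
    using assms(1)
  proof (elim disjE)
    assume "m = 2"
    with u2 show ?thesis by simp
  next
    assume "m = 3"
    with u3 show ?thesis by simp presburger
  next
    assume "m = 6"
    with u2 u3 show ?thesis by simp presburger
  qed
  then show thesis using that[of 1] that[of "- 1"] by auto
qed

section \<open>The order and its twists\<close>

locale cubic =
  fixes a b c :: int
  assumes ab: "a < b" and bc: "b < c"
begin

definition p where "p = b - a"
definition q where "q = c - b"
definition r where "r = c - a"

lemma p_pos: "0 < p" and q_pos: "0 < q" and r_eq: "r = p + q"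
  using ab bc by (simp_all add: p_def q_def r_def)

text \<open>
  The twist of \<open>R\<close> by \<open>(u, v)\<close>, that is \<open>(u, 1, 1/v) R\<close> plus the conductor, where \<open>1/v\<close> is an inverse
  modulo \<open>q r\<close>, when \<open>u\<close> and \<open>v\<close> are units modulo \<open>p r\<close> and \<open>q r\<close>. For \<open>u = v = 1\<close> this is the image of \<open>R\<close> in \<open>\<int>\<^sup>3\<close>. Writing the third congruence with \<open>v\<close>
  on the left avoids choosing that inverse; putting \<open>u\<close> and \<open>v\<close> on opposite sides is what makes the
  condition \<open>1 \<in> M u v\<close> the one that defines the subgroup \<open>K\<close>.
\<close>

definition M :: "int \<Rightarrow> int \<Rightarrow> triple set"
  where "M u v = {int_triple x y z | x y z.
    \<exists>j. p * r dvd x - u * (y - p * j) \<and> q * r dvd v * z - (y + q * j)}"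

lemma int_triple_in_M:
  "int_triple x y z \<in> M u v \<longleftrightarrow>
    (\<exists>j. p * r dvd x - u * (y - p * j) \<and> q * r dvd v * z - (y + q * j))"
  by (auto simp: M_def)

lemma M_cases:
  assumes "s \<in> M u v"
  obtains x y z j where "s = int_triple x y z"
    "p * r dvd x - u * (y - p * j)" "q * r dvd v * z - (y + q * j)"
  using assms by (auto simp: M_def)

lemma M_add: "s \<in> M u v \<Longrightarrow> t \<in> M u v \<Longrightarrow> s + t \<in> M u v"
proof (elim M_cases)
  fix x y z j x' y' z' j'
  assume "p * r dvd x - u * (y - p * j)" "q * r dvd v * z - (y + q * j)"
    and "p * r dvd x' - u * (y' - p * j')" "q * r dvd v * z' - (y' + q * j')"
    and st: "s = int_triple x y z" "t = int_triple x' y' z'"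
  then have "p * r dvd (x - u * (y - p * j)) + (x' - u * (y' - p * j'))"
    "q * r dvd (v * z - (y + q * j)) + (v * z' - (y' + q * j'))"
    by simp_all
  then have "p * r dvd (x + x') - u * ((y + y') - p * (j + j'))"
    "q * r dvd v * (z + z') - ((y + y') + q * (j + j'))"
    by (simp_all add: algebra_simps)
  then show ?thesis unfolding st int_triple_simps int_triple_in_M by blast
qed

text \<open>
  The quadratic term \<open>p\<^sup>2 j j'\<close> of the first congruence and \<open>q\<^sup>2 j j'\<close> of the third are absorbed
  by the same new parameter because \<open>p \<equiv> - q\<close> modulo \<open>r\<close>.
\<close>

lemma M_mult:
  assumes "s \<in> M u v" "t \<in> M u' v'"
  shows "s * t \<in> M (u * u') (v * v')"
proof -
  from assms obtain x y z j x' y' z' j'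
    where st: "s = int_triple x y z" "t = int_triple x' y' z'"
    and s: "p * r dvd x - u * (y - p * j)" "q * r dvd v * z - (y + q * j)"
    and t: "p * r dvd x' - u' * (y' - p * j')" "q * r dvd v' * z' - (y' + q * j')"
    by (elim M_cases)
  from s obtain k l where kl: "x - u * (y - p * j) = p * r * k" "v * z - (y + q * j) = q * r * l"
    by (elim dvdE)
  from t obtain k' l' where kl': "x' - u' * (y' - p * j') = p * r * k'"
    "v' * z' - (y' + q * j') = q * r * l'"
    by (elim dvdE)
  \<comment> \<open>The quadratic term is chosen for the first congruence; in the third it is off by \<open>q (p + q) j j'\<close>, a multiple of \<open>q r\<close>.\<close>
  define J where "J = y * j' + j * y' - p * j * j'"
  have x: "x = u * (y - p * j) + p * r * k" "x' = u' * (y' - p * j') + p * r * k'"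
    using kl kl' by simp_all
  have z: "v * z = (y + q * j) + q * r * l" "v' * z' = (y' + q * j') + q * r * l'"
    using kl kl' by simp_all
  have "x * x' - u * u' * (y * y' - p * J) =
      p * r * (k * x' + u * (y - p * j) * k')"
    unfolding x J_def by (simp add: algebra_simps)
  then have 1: "p * r dvd x * x' - u * u' * (y * y' - p * J)" by (metis dvd_triv_left)
  have "v * v' * (z * z') - (y * y' + q * J) = (v * z) * (v' * z') - (y * y' + q * J)"
    by simp
  also have "\<dots> = q * r * (j * j' + l * (v' * z') + (y + q * j) * l')"
    unfolding z J_def r_eq by (simp add: algebra_simps)
  finally have 2: "q * r dvd v * v' * (z * z') - (y * y' + q * J)" by (metis dvd_triv_left)
  show ?thesis
    unfolding st int_triple_simps int_triple_in_M using 1 2 by blast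
qed

lemma M_mod: "M (u mod (p * r)) (v mod (q * r)) = M u v"
proof -
  have "p * r dvd x - (u mod (p * r)) * y \<longleftrightarrow> p * r dvd x - u * y" for x y
    by (metis mod_eq_dvd_iff mod_mult_left_eq)
  moreover have "q * r dvd (v mod (q * r)) * z - y \<longleftrightarrow> q * r dvd v * z - y" for y z
    by (metis mod_eq_dvd_iff mod_mult_left_eq)
  ultimately show ?thesis unfolding M_def by presburger
qed

lemma one_in_M11: "1 \<in> M 1 1"
  unfolding one_eq_int_triple int_triple_in_M by (rule exI[of _ 0]) simp

lemma scalar_in_M11: "int_triple n n n \<in> M 1 1"
  unfolding int_triple_in_M by (rule exI[of _ 0]) simp

lemma generator_in_M: "q * r dvd v * v' - 1 \<Longrightarrow> int_triple u 1 v' \<in> M u v"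
  unfolding int_triple_in_M by (rule exI[of _ 0]) simp

lemma conductor_in_M:
  "int_triple (p * r * k) 0 (q * r * l) \<in> M u v"
  unfolding int_triple_in_M by (rule exI[of _ 0]) simp

lemma conductor_mid_in_M: "int_triple 0 (p * q * k) 0 \<in> M 1 1"
proof -
  have "0 - 1 * (p * q * k - p * (q * k)) = 0" "1 * 0 - (p * q * k + q * (q * k)) = q * r * (- k)"
    by (simp_all add: r_eq algebra_simps)
  then show ?thesis unfolding int_triple_in_M by (metis dvd_0_right dvd_triv_left)
qed

text \<open>
  Since \<open>0\<close> and \<open>-1\<close> lie in \<open>M 1 1\<close>, these closure conditions make every nonempty such set a submodule over
  the image \<open>M 1 1\<close> of \<open>R\<close>.
\<close>

definition R_module :: "triple set \<Rightarrow> bool"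
  where "R_module A \<longleftrightarrow> (\<forall>s\<in>A. \<forall>t\<in>A. s + t \<in> A) \<and> (\<forall>s\<in>M 1 1. \<forall>t\<in>A. s * t \<in> A)"

lemma R_module_add: "R_module A \<Longrightarrow> s \<in> A \<Longrightarrow> t \<in> A \<Longrightarrow> s + t \<in> A"
  and R_module_mult: "R_module A \<Longrightarrow> s \<in> M 1 1 \<Longrightarrow> t \<in> A \<Longrightarrow> s * t \<in> A"
  by (simp_all add: R_module_def)

lemma R_module_M: "R_module (M u v)"
  using M_add M_mult[of _ 1 1 _ u v] by (auto simp: R_module_def)

lemma span_prod_M11:
  assumes "R_module A" shows "M 1 1 \<star> A = A"
proof
  show "M 1 1 \<star> A \<subseteq> A"
    by (rule span_prod_subsetI) (use assms in \<open>auto simp: R_module_def\<close>)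
  show "A \<subseteq> M 1 1 \<star> A"
    using span_prod_mult[OF one_in_M11, of _ A] by auto
qed

lemma R_module_span_prod:
  assumes "R_module A" shows "R_module (A \<star> B)"
  unfolding R_module_def
  using span_prod_mult_left[of _ "M 1 1" _ A B] span_prod_add span_prod_M11[OF assms] by simp

lemma R_module_scale:
  assumes "R_module A" shows "R_module ((\<lambda>s. k * s) ` A)"
  unfolding R_module_def
  using R_module_add[OF assms] R_module_mult[OF assms]
  by (auto simp: mult.left_commute[of _ k] simp flip: distrib_left)

text \<open>
  It suffices to produce \<open>1\<close>. The product of the generators \<open>(u, 1, v')\<close> and \<open>(u', 1, v)\<close> is \<open>1\<close> plus
  an element \<open>f\<close> of the conductor, and \<open>f\<close> lies in the product of the ideals as well: writing
  \<open>1 = u u' - p r k\<close> in the first coordinate, \<open>f\<close> is a multiple of a generator times a conductor element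
  plus a product of two conductor elements.
\<close>

lemma M_mult_inverse:
  assumes u: "p * r dvd u * u' - 1" and v: "q * r dvd v * v' - 1"
  shows "M u v \<star> M u' v' = M 1 1"
proof
  have "M (u * u') (v * v') = M 1 1"
    using u v by (metis M_mod mod_eq_dvd_iff)
  then show "M u v \<star> M u' v' \<subseteq> M 1 1"
    using M_mult[of _ u v _ u' v'] M_add[of _ 1 1] by (intro span_prod_subsetI) auto
  from u obtain k where k: "u * u' - 1 = p * r * k" ..
  from v obtain l where l: "v * v' - 1 = q * r * l" ..
  have al: "int_triple u 1 v' \<in> M u v" using generator_in_M[OF v] .
  have be: "int_triple u' 1 v \<in> M u' v'"
    using generator_in_M[of v' v u'] v by (simp add: mult.commute)
  have de: "int_triple (p * r * k) 0 (q * r * l) \<in> M u v" for k l u v by (rule conductor_in_M)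
  have "int_triple 1 1 1 = int_triple u 1 v' * int_triple u' 1 v
      + int_triple u 1 v' * int_triple (p * r * (- k * u')) 0 (q * r * (- l * v))
      + int_triple (p * r * k) 0 (q * r * l) * int_triple (p * r * k) 0 (q * r * l)"
  proof -
    have *: "1 = w * w' + w * (m * (- n * w')) + m * n * (m * n)" if "w * w' - 1 = m * n" for w w' m n :: int
    proof -
      have "w * w' + w * (m * (- n * w')) + m * n * (m * n) = w * w' - (w * w') * (m * n) + (m * n) * (m * n)"
        by (simp add: algebra_simps)
      also have "\<dots> = 1" unfolding that[symmetric] by (simp add: algebra_simps)
      finally show ?thesis by simp
    qed
    show ?thesis unfolding int_triple_simps using *[OF k] *[of v' v "q * r" l] l by (simp add: mult.commute)
  qed
  then have one: "1 \<in> M u v \<star> M u' v'"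
    unfolding one_eq_int_triple by (metis al be de span_prod_mult span_prod_add)
  show "M 1 1 \<subseteq> M u v \<star> M u' v'"
    using R_module_mult[OF R_module_span_prod[OF R_module_M] _ one] by auto
qed

text \<open>
  The inclusion from right to left needs no generators: multiply \<open>M (u u') (v v')\<close> by
  \<open>R = M u'' v'' M u' v'\<close>, with \<open>u''\<close> and \<open>v''\<close> inverse to \<open>u'\<close> and \<open>v'\<close>, and use the other inclusion
  for the first two factors.
\<close>

lemma span_prod_M:
  assumes u: "coprime u' (p * r)" and v: "coprime v' (q * r)"
  shows "M u v \<star> M u' v' = M (u * u') (v * v')"
proof
  show "M u v \<star> M u' v' \<subseteq> M (u * u') (v * v')"
    by (intro span_prod_subsetI M_mult M_add)
  obtain u'' where u'': "p * r dvd u' * u'' - 1" using unit_inverse[OF u] by blast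
  obtain v'' where v'': "q * r dvd v' * v'' - 1" using unit_inverse[OF v] by blast
  have "p * r dvd u * (u' * u'' - 1)" "q * r dvd v * (v' * v'' - 1)" using u'' v'' by simp_all
  then have "p * r dvd (u * u' * u'') - u" "q * r dvd (v * v' * v'') - v"
    by (simp_all add: algebra_simps)
  then have uv: "M (u * u' * u'') (v * v' * v'') = M u v"
    by (metis M_mod mod_eq_dvd_iff)
  have "M (u * u') (v * v') = M 1 1 \<star> M (u * u') (v * v')"
    by (rule span_prod_M11[OF R_module_M, symmetric])
  also have "\<dots> = M (u * u') (v * v') \<star> M u'' v'' \<star> M u' v'"
    unfolding M_mult_inverse[OF u'' v'', symmetric] by (simp only: span_prod_ac)
  also have "\<dots> \<subseteq> M u v \<star> M u' v'"
  proof (rule span_prod_subsetI[OF _ span_prod_add])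
    fix s t assume "s \<in> M (u * u') (v * v') \<star> M u'' v''" and t: "t \<in> M u' v'"
    moreover have "M (u * u') (v * v') \<star> M u'' v'' \<subseteq> M u v"
      unfolding uv[symmetric] by (intro span_prod_subsetI M_mult M_add)
    ultimately show "s * t \<in> M u v \<star> M u' v'" by (blast intro: span_prod_mult)
  qed
  finally show "M (u * u') (v * v') \<subseteq> M u v \<star> M u' v'" .
qed

section \<open>Principal twists\<close>

lemma R_module_int_mult: "R_module A \<Longrightarrow> s \<in> A \<Longrightarrow> int_triple n n n * s \<in> A"
  using R_module_mult scalar_in_M11 by blast

definition integral :: "triple set \<Rightarrow> bool"
  where "integral A \<longleftrightarrow> (\<forall>s\<in>A. \<exists>x y z. s = int_triple x y z)"

lemma integral_M: "integral (M u v)"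
  by (auto simp: integral_def M_def)

lemma integral_span_prod: "integral A \<Longrightarrow> integral B \<Longrightarrow> integral (A \<star> B)"
  unfolding integral_def
proof
  fix s assume A: "\<forall>s\<in>A. \<exists>x y z. s = int_triple x y z" and B: "\<forall>s\<in>B. \<exists>x y z. s = int_triple x y z"
    and "s \<in> A \<star> B"
  from this(3) show "\<exists>x y z. s = int_triple x y z"
  proof (induction rule: span_prod_induct)
    case (mult s t)
    with A B show ?case by (metis int_triple_simps(4))
  next
    case (add s t)
    then show ?case by (metis int_triple_simps(2))
  qed
qed

abbreviation coordinates :: "(triple \<Rightarrow> rat) set"
  where "coordinates \<equiv> {at_a, at_b, at_c}"

lemma coordinate_hom:
  assumes "f \<in> coordinates"
  shows "f (s + t) = f s + f t" "f (s * t) = f s * f t" "f 1 = 1" "f (int_triple n n n) = of_int n"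
  using assms by auto

lemma integral_coordinate:
  assumes "integral A" "s \<in> A" "f \<in> coordinates" obtains n where "f s = of_int n"
proof -
  from assms(1,2) obtain x y z where "s = int_triple x y z" unfolding integral_def by blast
  with assms(3) that show thesis by auto
qed

text \<open>
  The coordinates of the elements of \<open>A\<close> are integers, so each coordinate of a sum of products is an
  integer combination of coordinates of elements of \<open>B\<close>, and \<open>B\<close> is closed under such combinations.
\<close>

lemma coordinate_attained:
  assumes A: "integral A" and B: "R_module B" and f: "f \<in> coordinates" and s: "s \<in> A \<star> B"
  shows "\<exists>t\<in>B. f t = f s"
  using s
proof (induction rule: span_prod_induct)
  case (mult s t)
  obtain n where n: "f s = of_int n" using integral_coordinate[OF A mult(1) f] .
  have "f (int_triple n n n * t) = f (s * t)"
    by (simp only: coordinate_hom[OF f] n)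
  then show ?case using R_module_int_mult[OF B mult(2)] by blast
next
  case (add s t)
  then obtain s' t' where "s' \<in> B" "t' \<in> B" "f s' = f s" "f t' = f t" by blast
  then show ?case
    by (intro bexI[of _ "s' + t'"]) (simp_all add: coordinate_hom[OF f] R_module_add[OF B])
qed

lemma one_minus_in_M11: "s \<in> M 1 1 \<Longrightarrow> 1 - s \<in> M 1 1"
proof -
  assume "s \<in> M 1 1"
  then have "1 + int_triple (- 1) (- 1) (- 1) * s \<in> M 1 1"
    by (intro M_add one_in_M11 R_module_int_mult R_module_M)
  moreover have "int_triple (- 1) (- 1) (- 1) = - 1" by (simp add: one_eq_int_triple)
  ultimately show ?thesis by simp
qed

text \<open>
  An ideal of \<open>R\<close> that generates the unit ideal of \<open>\<int>\<^sup>3\<close> contains \<open>1\<close>, as in lying over. Explicitly, if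
  \<open>s, t, w\<close> have first, second and third coordinate \<open>1\<close>, respectively, then \<open>(1 - s) (1 - t) (1 - w) = 0\<close>,
  and expanding the product exhibits \<open>1\<close> as an element of the ideal.
\<close>

lemma one_in_ideal_if_coordinates_one:
  assumes B: "R_module B" and sub: "B \<subseteq> M 1 1"
    and coord: "\<And>f. f \<in> coordinates \<Longrightarrow> \<exists>t\<in>B. f t = 1"
  shows "1 \<in> B"
proof -
  from coord obtain s t w where stw: "s \<in> B" "t \<in> B" "w \<in> B"
    and one: "at_a s = 1" "at_b t = 1" "at_c w = 1"
    by (metis insertCI)
  have "1 = s + (1 - s) * (t + (1 - t) * w)"
    using one by (cases s; cases t; cases w) (simp add: one_triple_def)
  moreover have "s + (1 - s) * (t + (1 - t) * w) \<in> B"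
    by (intro R_module_add[OF B] R_module_mult[OF B] one_minus_in_M11 stw subsetD[OF sub])
  ultimately show ?thesis by metis
qed

text \<open>
  The rigidity principle. As \<open>1 \<in> A\<close>, the inverse \<open>B\<close> is contained in \<open>A B = R\<close>. As \<open>A\<close> is contained in
  \<open>\<int>\<^sup>3\<close>, the coordinates of \<open>1 \<in> A B\<close> are already attained on \<open>B\<close>. So \<open>B\<close> is an ideal of \<open>R\<close> that
  contains \<open>1\<close>, hence \<open>B = R\<close> and \<open>A = A B = R\<close>.
\<close>

lemma ideal_eq_R_if_one:
  assumes A: "R_module A" "integral A" "1 \<in> A" and B: "R_module B" and AB: "A \<star> B = M 1 1"
  shows "A = M 1 1"
proof -
  have sub: "B \<subseteq> M 1 1"
    using span_prod_mult[OF A(3), of _ B] AB by auto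
  have "\<exists>t\<in>B. f t = 1" if "f \<in> coordinates" for f
    using coordinate_attained[OF A(2) B that, of 1] AB one_in_M11 coordinate_hom(3)[OF that] by simp
  then have "1 \<in> B" by (rule one_in_ideal_if_coordinates_one[OF B sub])
  then have "M 1 1 \<subseteq> B"
    using R_module_mult[OF B] by (metis mult.right_neutral subsetI)
  with sub have "B = M 1 1" by blast
  then show ?thesis using AB span_prod_M11[OF A(1)] span_prod_commute by metis
qed

lemma M_eq_M11_iff:
  assumes u: "coprime u (p * r)" and v: "coprime v (q * r)"
  shows "M u v = M 1 1 \<longleftrightarrow> 1 \<in> M u v"
proof
  obtain u' where u': "p * r dvd u * u' - 1" using unit_inverse[OF u] by blast
  obtain v' where v': "q * r dvd v * v' - 1" using unit_inverse[OF v] by blast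
  assume "1 \<in> M u v"
  then show "M u v = M 1 1"
    by (rule ideal_eq_R_if_one[OF R_module_M integral_M _ R_module_M M_mult_inverse[OF u' v']])
qed (use one_in_M11 in simp)

text \<open>
  Membership of \<open>1\<close> says \<open>u (1 - p j) \<equiv> 1\<close> modulo \<open>p r\<close> and \<open>v \<equiv> 1 + q j\<close> modulo \<open>q r\<close>. The second
  congruence gives \<open>j \<equiv> (v - 1) / q\<close> modulo \<open>r\<close>, and eliminating \<open>j\<close> from the first leaves the third
  divisibility condition.
\<close>

lemma one_in_M_iff:
  "1 \<in> M u v \<longleftrightarrow> p dvd u - 1 \<and> q dvd v - 1 \<and> r dvd (u * (v - 1)) div q - (u - 1) div p"
proof
  assume "1 \<in> M u v"
  then obtain j where j: "p * r dvd 1 - u * (1 - p * j)" "q * r dvd v - (1 + q * j)"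
    unfolding one_eq_int_triple int_triple_in_M by auto
  from j(1) obtain k where k: "1 - u * (1 - p * j) = p * r * k" ..
  from j(2) obtain l where l: "v - (1 + q * j) = q * r * l" ..
  have u: "u - 1 = p * (u * j - r * k)" using k by (simp add: algebra_simps)
  have v: "v - 1 = q * (j + r * l)" using l by (simp add: algebra_simps)
  have "(u * (v - 1)) div q = u * (j + r * l)"
    unfolding v using q_pos by (simp add: mult.left_commute[of u])
  moreover have "(u - 1) div p = u * j - r * k" unfolding u using p_pos by simp
  ultimately have "(u * (v - 1)) div q - (u - 1) div p = r * (u * l + k)"
    by (simp add: algebra_simps)
  then show "p dvd u - 1 \<and> q dvd v - 1 \<and> r dvd (u * (v - 1)) div q - (u - 1) div p"
    using u v by (metis dvd_triv_left)
next
  assume *: "p dvd u - 1 \<and> q dvd v - 1 \<and> r dvd (u * (v - 1)) div q - (u - 1) div p"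
  then obtain i l where i: "u - 1 = p * i" and l: "v - 1 = q * l" by (auto elim!: dvdE)
  have "(u * (v - 1)) div q = u * l" unfolding l using q_pos by (simp add: mult.left_commute[of u])
  moreover have "(u - 1) div p = i" unfolding i using p_pos by simp
  ultimately have "r dvd u * l - i" using * by simp
  then obtain k where k: "u * l - i = r * k" ..
  have "1 - u * (1 - p * l) = p * (u * l) - (u - 1)" by (simp add: algebra_simps)
  also have "\<dots> = p * (u * l - i)" unfolding i by (simp add: algebra_simps)
  finally have 1: "p * r dvd 1 - u * (1 - p * l)" unfolding k by simp
  have 2: "v * 1 - (1 + q * l) = 0" using l by simp
  show "1 \<in> M u v"
    unfolding one_eq_int_triple int_triple_in_M using 1 2 by (metis dvd_0_right)
qed

lemma M_scale_signs:
  assumes e: "is_sign e" and f: "is_sign f"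
  shows "M (e * u) (f * v) = (\<lambda>s. int_triple e 1 f * s) ` M u v"
proof -
  have dvd_sign: "m dvd e * x \<longleftrightarrow> m dvd x" "m dvd f * x \<longleftrightarrow> m dvd x" for m x
    using e f by auto
  have iff: "int_triple (e * x) y (f * z) \<in> M (e * u) (f * v) \<longleftrightarrow> int_triple x y z \<in> M u v" for x y z
  proof -
    have "e * x - e * u * (y - p * j) = e * (x - u * (y - p * j))" for j by (simp add: algebra_simps)
    moreover have fz: "f * v * (f * z) = v * z" using f by auto
    ultimately show ?thesis unfolding int_triple_in_M fz by (simp add: dvd_sign)
  qed
  show ?thesis
  proof
    show "(\<lambda>s. int_triple e 1 f * s) ` M u v \<subseteq> M (e * u) (f * v)"
    proof
      fix t assume "t \<in> (\<lambda>s. int_triple e 1 f * s) ` M u v"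
      then obtain s where s: "s \<in> M u v" "t = int_triple e 1 f * s" by blast
      then obtain x y z where "s = int_triple x y z" by (auto elim: M_cases)
      with s iff[of x y z] show "t \<in> M (e * u) (f * v)" by simp
    qed
    show "M (e * u) (f * v) \<subseteq> (\<lambda>s. int_triple e 1 f * s) ` M u v"
    proof
      fix t assume t: "t \<in> M (e * u) (f * v)"
      then obtain x y z where xyz: "t = int_triple x y z" by (auto elim: M_cases)
      have cancel: "e * (e * x) = x" "f * (f * z) = z" using e f by auto
      have "t = int_triple e 1 f * int_triple (e * x) y (f * z)"
        unfolding int_triple_simps cancel xyz by simp
      moreover have "int_triple (e * x) y (f * z) \<in> M u v"
        using iff[of "e * x" y "f * z"] t unfolding cancel xyz by blast
      ultimately show "t \<in> (\<lambda>s. int_triple e 1 f * s) ` M u v" by blast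
    qed
  qed
qed

lemma M_scale_signs_self:
  assumes "is_sign e" "is_sign f"
  shows "M u v = (\<lambda>s. int_triple e 1 f * s) ` M (e * u) (f * v)"
  using M_scale_signs[OF assms, of "e * u" "f * v"] assms by auto

lemma M11_scale_sign: "is_sign d \<Longrightarrow> (\<lambda>s. int_triple d d d * s) ` M 1 1 = M 1 1"
proof
  assume d: "is_sign d"
  show sub: "(\<lambda>s. int_triple d d d * s) ` M 1 1 \<subseteq> M 1 1"
    using R_module_int_mult[OF R_module_M] by blast
  have "int_triple d d d * (int_triple d d d * s) = s" for s
    using d by (cases s) (auto simp: int_triple_def)
  then show "M 1 1 \<subseteq> (\<lambda>s. int_triple d d d * s) ` M 1 1"
    using R_module_int_mult[OF R_module_M] by (metis imageI subsetI)
qed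

text \<open>
  A generator \<open>k\<close> lies in \<open>M u v\<close>, so it is integral, and its coordinates divide those of every element
  of \<open>M u v\<close>: the first divides both \<open>u\<close> and \<open>p r\<close>, the second divides \<open>1\<close>, the third divides both an
  inverse of \<open>v\<close> and \<open>q r\<close>. So all three are signs. As \<open>-1 \<in> R\<close>, the middle one can be made \<open>1\<close>.
\<close>

lemma M_principal_iff:
  assumes u: "coprime u (p * r)" and v: "coprime v (q * r)"
  shows "(\<exists>k. M u v = (\<lambda>s. k * s) ` M 1 1) \<longleftrightarrow>
    (\<exists>e f. is_sign e \<and> is_sign f \<and> M (e * u) (f * v) = M 1 1)"
proof
  assume "\<exists>e f. is_sign e \<and> is_sign f \<and> M (e * u) (f * v) = M 1 1"
  then show "\<exists>k. M u v = (\<lambda>s. k * s) ` M 1 1" using M_scale_signs_self by metis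
next
  assume "\<exists>k. M u v = (\<lambda>s. k * s) ` M 1 1"
  then obtain k where k: "M u v = (\<lambda>s. k * s) ` M 1 1" by blast
  then have "k \<in> M u v" using one_in_M11 by force
  then obtain k1 k2 k3 where k123: "k = int_triple k1 k2 k3" by (auto elim: M_cases)
  have dvd: "k1 dvd x \<and> k2 dvd y \<and> k3 dvd z" if "int_triple x y z \<in> M u v" for x y z
    using that unfolding k k123 by (auto elim!: M_cases)
  obtain v' where v': "q * r dvd v * v' - 1" "coprime v' (q * r)" using unit_inverse[OF v] .
  have gen: "k1 dvd u" "k2 dvd 1" "k3 dvd v'"
    using dvd[OF generator_in_M[OF v'(1)]] by auto
  have con: "k1 dvd p * r" "k3 dvd q * r" using dvd[OF conductor_in_M[of 1 1]] by auto
  have unit: "is_sign k" if "k dvd 1" for k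
    using that by (auto simp: abs_if split: if_splits)
  have sg: "is_sign k1" "is_sign k2" "is_sign k3"
    using unit coprime_common_divisor[OF u gen(1) con(1)] gen(2)
      coprime_common_divisor[OF v'(2) gen(3) con(2)] by blast+
  have sg': "is_sign (k2 * k1)" "is_sign (k2 * k3)" using sg by auto
  have "M (k2 * k1 * u) (k2 * k3 * v) = (\<lambda>s. int_triple (k2 * k1) 1 (k2 * k3) * s) ` M u v"
    by (rule M_scale_signs[OF sg'])
  also have "\<dots> = (\<lambda>s. int_triple (k2 * k1) 1 (k2 * k3) * k * s) ` M 1 1"
    unfolding k image_image by (simp add: mult.assoc)
  also have "int_triple (k2 * k1) 1 (k2 * k3) * k = int_triple k2 k2 k2"
    using sg unfolding k123 by auto
  also have "(\<lambda>s. int_triple k2 k2 k2 * s) ` M 1 1 = M 1 1" by (rule M11_scale_sign[OF sg(2)])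
  finally show "\<exists>e f. is_sign e \<and> is_sign f \<and> M (e * u) (f * v) = M 1 1"
    using sg' by blast
qed

section \<open>Invertible ideals are twists up to scaling\<close>

text \<open>
  If \<open>s = t w\<close> with \<open>t \<in> A\<close> and \<open>w \<in> B\<close>, then \<open>s x = t (x w)\<close> where \<open>x w \<in> A B = R\<close> has integer
  coordinates, so a denominator of the coordinate of \<open>t\<close> works for all \<open>x \<in> A\<close>. Applied to \<open>s = 1\<close> this
  bounds the denominators of an invertible ideal.
\<close>

lemma coordinate_denominator:
  assumes f: "f \<in> coordinates" and B: "R_module B" and AB: "A \<star> B = M 1 1" and s: "s \<in> A \<star> B"
  shows "\<exists>d::int. d \<noteq> 0 \<and> (\<forall>x\<in>A. \<exists>n. of_int d * f (s * x) = of_int n)"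
  using s
proof (induction rule: span_prod_induct)
  case (mult s t)
  obtain m d where md: "f s = of_int m / of_int d" "d \<noteq> 0"
    by (cases "f s") (auto simp: Fract_of_int_quotient)
  have "\<exists>n. of_int d * f (s * t * x) = of_int n" if x: "x \<in> A" for x
  proof -
    obtain n where n: "f (x * t) = of_int n"
      using integral_coordinate[OF integral_M _ f, of "x * t" 1 1] span_prod_mult[OF x mult(2)] AB by metis
    have "of_int d * f (s * t * x) = of_int d * f s * f (x * t)"
      by (simp add: coordinate_hom[OF f])
    also have "\<dots> = of_int (m * n)" unfolding n md using md(2) by simp
    finally show ?thesis by blast
  qed
  with md(2) show ?case by blast
next
  case (add s t)
  then obtain d d' where d: "d \<noteq> 0" "\<forall>x\<in>A. \<exists>n. of_int d * f (s * x) = of_int n"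
    and d': "d' \<noteq> 0" "\<forall>x\<in>A. \<exists>n. of_int d' * f (t * x) = of_int n" by blast
  have "\<exists>n. of_int (d * d') * f ((s + t) * x) = of_int n" if "x \<in> A" for x
  proof -
    from d(2) d'(2) that obtain n n' where "of_int d * f (s * x) = of_int n"
      "of_int d' * f (t * x) = of_int n'" by blast
    moreover have "of_int (d * d') * f ((s + t) * x) =
        of_int d' * (of_int d * f (s * x)) + of_int d * (of_int d' * f (t * x))"
      by (simp add: coordinate_hom[OF f] algebra_simps)
    ultimately have "of_int (d * d') * f ((s + t) * x) = of_int (d' * n + d * n')" by simp
    then show ?thesis by blast
  qed
  with d(1) d'(1) show ?case by (intro exI[of _ "d * d'"]) auto
qed

text \<open>
  The coordinate projection of an invertible ideal has bounded denominators, so it is a multiple of an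
  ideal of \<open>\<int>\<close>, which is principal.
\<close>

lemma coordinate_principal:
  assumes f: "f \<in> coordinates" and A: "R_module A" and AB: "A \<star> B = M 1 1" and B: "R_module B"
  obtains g where "g \<noteq> 0" "\<exists>s\<in>A. f s = g" "\<And>s. s \<in> A \<Longrightarrow> \<exists>n. f s = of_int n * g"
proof -
  obtain d :: int where d: "d \<noteq> 0" "\<And>x. x \<in> A \<Longrightarrow> \<exists>n. of_int d * f x = of_int n"
    using coordinate_denominator[OF f B AB, of 1] AB one_in_M11 by auto
  define S where "S = {n. \<exists>s\<in>A. of_int d * f s = of_int n}"
  have S: "n \<in> S" if "s \<in> A" "of_int d * f s = of_int n" for s n using that unfolding S_def by blast
  have "\<exists>s\<in>A. f s \<noteq> 0"
  proof (rule ccontr)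
    assume *: "\<not> (\<exists>s\<in>A. f s \<noteq> 0)"
    have "f s = 0" if "s \<in> A \<star> B" for s
      using that by (induction rule: span_prod_induct) (use * in \<open>auto simp: coordinate_hom[OF f]\<close>)
    then show False using AB one_in_M11 coordinate_hom(3)[OF f] by force
  qed
  then obtain s0 where s0: "s0 \<in> A" "f s0 \<noteq> 0" by blast
  then obtain n0 where n0: "of_int d * f s0 = of_int n0" using d(2) by blast
  have "\<exists>g\<in>S. g \<noteq> 0 \<and> (\<forall>n\<in>S. g dvd n)"
  proof (rule int_ideal_principal[of S n0])
    fix m n assume "m \<in> S" "n \<in> S"
    then obtain s t where "s \<in> A" "t \<in> A" "of_int d * f s = of_int m" "of_int d * f t = of_int n"
      unfolding S_def by blast
    then show "m + n \<in> S"
      by (intro S[OF R_module_add[OF A, of s t]]) (simp_all add: coordinate_hom[OF f] distrib_left)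
  next
    fix m n assume "n \<in> S"
    then obtain s where "s \<in> A" "of_int d * f s = of_int n" unfolding S_def by blast
    then show "m * n \<in> S"
      by (intro S[OF R_module_int_mult[OF A, of s m]])
        (simp_all add: coordinate_hom[OF f] mult.left_commute)
  next
    show "n0 \<in> S" using S s0(1) n0 by blast
    show "n0 \<noteq> 0" using n0 s0(2) d(1) by auto
  qed
  then obtain g where g: "g \<in> S" "g \<noteq> 0" "\<And>n. n \<in> S \<Longrightarrow> g dvd n" by blast
  show thesis
  proof (rule that[of "of_int g / of_int d"])
    show "of_int g / of_int d \<noteq> (0::rat)" using g(2) d(1) by simp
    from g(1) obtain s where "s \<in> A" "of_int d * f s = of_int g" unfolding S_def by blast
    with d(1) show "\<exists>s\<in>A. f s = of_int g / of_int d" by (auto simp: field_simps)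
  next
    fix s assume s: "s \<in> A"
    then obtain n where n: "of_int d * f s = of_int n" using d(2) by blast
    then obtain k where "n = g * k" using g(3) S[OF s] by blast
    with n d(1) have "f s = of_int k * (of_int g / of_int d)" by (simp add: field_simps)
    then show "\<exists>n. f s = of_int n * (of_int g / of_int d)" by blast
  qed
qed

definition primitive :: "triple set \<Rightarrow> bool"
  where "primitive A \<longleftrightarrow> (\<forall>f\<in>coordinates. \<exists>s\<in>A. f s = 1)"

lemma primitive_scaling:
  assumes A: "R_module A" and B: "R_module B" and AB: "A \<star> B = M 1 1"
  obtains k k' where "k * k' = 1" "integral ((\<lambda>s. k * s) ` A)" "primitive ((\<lambda>s. k * s) ` A)"
    "(\<lambda>s. k * s) ` A \<star> (\<lambda>s. k' * s) ` B = M 1 1"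
proof -
  have "at_a \<in> coordinates" "at_b \<in> coordinates" "at_c \<in> coordinates" by auto
  note principal = this[THEN coordinate_principal[OF _ A AB B]]
  obtain g1 where g1: "g1 \<noteq> 0" "\<exists>s\<in>A. at_a s = g1" "\<And>s. s \<in> A \<Longrightarrow> \<exists>n. at_a s = of_int n * g1"
    using principal(1) by blast
  obtain g2 where g2: "g2 \<noteq> 0" "\<exists>s\<in>A. at_b s = g2" "\<And>s. s \<in> A \<Longrightarrow> \<exists>n. at_b s = of_int n * g2"
    using principal(2) by blast
  obtain g3 where g3: "g3 \<noteq> 0" "\<exists>s\<in>A. at_c s = g3" "\<And>s. s \<in> A \<Longrightarrow> \<exists>n. at_c s = of_int n * g3"
    using principal(3) by blast
  define k where "k = Triple (1 / g1) (1 / g2) (1 / g3)"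
  define k' where "k' = Triple g1 g2 g3"
  have kk': "k * k' = 1" using g1(1) g2(1) g3(1) by (simp add: k_def k'_def one_triple_def)
  moreover have "integral ((\<lambda>s. k * s) ` A)"
    unfolding integral_def
  proof clarify
    fix s assume s: "s \<in> A"
    obtain x y z where "at_a s = of_int x * g1" "at_b s = of_int y * g2" "at_c s = of_int z * g3"
      using g1(3)[OF s] g2(3)[OF s] g3(3)[OF s] by metis
    then have "k * s = int_triple x y z"
      using g1(1) g2(1) g3(1) by (cases s) (simp add: k_def int_triple_def)
    then show "\<exists>x y z. k * s = int_triple x y z" by blast
  qed
  moreover have "primitive ((\<lambda>s. k * s) ` A)"
  proof -
    obtain s1 s2 s3 where s: "s1 \<in> A" "at_a s1 = g1" "s2 \<in> A" "at_b s2 = g2" "s3 \<in> A" "at_c s3 = g3"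
      using g1(2) g2(2) g3(2) by metis
    then have "at_a (k * s1) = 1" "at_b (k * s2) = 1" "at_c (k * s3) = 1"
      using g1(1) g2(1) g3(1) by (simp_all add: k_def)
    with s(1,3,5) show ?thesis unfolding primitive_def by blast
  qed
  moreover have "(\<lambda>s. k * s) ` A \<star> (\<lambda>s. k' * s) ` B = M 1 1"
  proof -
    have "(\<lambda>s. k * s) ` A \<star> (\<lambda>s. k' * s) ` B = (\<lambda>s. k * s) ` ((\<lambda>s. k' * s) ` (A \<star> B))"
      unfolding span_prod_scale[of k A] span_prod_commute[of A] span_prod_scale[of k' B] ..
    also have "\<dots> = A \<star> B" by (simp add: image_image kk' flip: mult.assoc)
    finally show ?thesis using AB by simp
  qed
  ultimately show thesis using that by blast
qed

lemma cofactor_integral: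
  assumes "primitive A" "A \<star> B = M 1 1"
  shows "integral B"
  unfolding integral_def
proof
  fix t assume t: "t \<in> B"
  have "\<exists>n. f t = of_int n" if f: "f \<in> coordinates" for f
  proof -
    from assms(1) f obtain s where s: "s \<in> A" "f s = 1" unfolding primitive_def by blast
    obtain n where "f (s * t) = of_int n"
      using integral_coordinate[OF integral_M _ f] span_prod_mult[OF s(1) t] assms(2) by metis
    then show ?thesis using s(2) by (simp add: coordinate_hom[OF f])
  qed
  then obtain x y z where "at_a t = of_int x" "at_b t = of_int y" "at_c t = of_int z"
    by (meson insertCI)
  then have "t = int_triple x y z" by (cases t) (simp add: int_triple_def)
  then show "\<exists>x y z. t = int_triple x y z" by blast
qed

text \<open>
  The values of an integer polynomial at two integers differ by a multiple of the difference of the integers.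
\<close>

lemma M11_congruences:
  assumes "int_triple x y z \<in> M 1 1"
  shows "p dvd y - x" "q dvd z - y" "r dvd z - x"
proof -
  from assms obtain j where "p * r dvd x - 1 * (y - p * j)" "q * r dvd 1 * z - (y + q * j)"
    unfolding int_triple_in_M by blast
  then obtain k l where k: "x - 1 * (y - p * j) = p * r * k" and l: "1 * z - (y + q * j) = q * r * l"
    by (auto elim!: dvdE)
  have "y - x = p * (j - r * k)" using k by (simp add: algebra_simps)
  then show "p dvd y - x" by simp
  have "z - y = q * (j + r * l)" using l by (simp add: algebra_simps)
  then show "q dvd z - y" by simp
  have "z - x = r * (j + q * l - p * k)" using k l by (simp add: r_eq algebra_simps)
  then show "r dvd z - x" by simp
qed

text \<open>
  The element is prime to \<open>l\<close> in those coordinates in which \<open>l\<close> divides the conductor. In the other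
  coordinates the congruences defining \<open>R\<close> are vacuous at \<open>l\<close>, and divisibility by \<open>l\<close> does not affect
  generation modulo the conductor.
\<close>

definition locally_unit :: "int \<Rightarrow> triple \<Rightarrow> bool"
  where "locally_unit l s \<longleftrightarrow> (\<exists>x y z. s = int_triple x y z \<and>
    (l dvd p * r \<longrightarrow> \<not> l dvd x) \<and> (l dvd p * q \<longrightarrow> \<not> l dvd y) \<and> (l dvd q * r \<longrightarrow> \<not> l dvd z))"

text \<open>
  Some product \<open>s t\<close> with \<open>s \<in> A\<close>, \<open>t \<in> B\<close> has a given coordinate prime to \<open>l\<close>, since \<open>1\<close> is a sum of
  such products. As \<open>s t \<in> R\<close>, any two of its coordinates that are linked by a difference of roots divisible
  by \<open>l\<close> are congruent modulo \<open>l\<close>. If \<open>l\<close> divides two of \<open>p, q, r\<close> it divides all three; in every case the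
  coordinates in which \<open>l\<close> divides the conductor are linked to each other. Hence one suitably chosen
  coordinate decides about all of them.
\<close>

lemma local_unit_exists:
  assumes A: "integral A" and B: "integral B" and AB: "A \<star> B = M 1 1" and l: "Factorial_Ring.prime l"
  shows "\<exists>s\<in>A. locally_unit l s"
proof -
  have ex: "\<exists>s\<in>A. \<exists>t\<in>B. \<not> (\<exists>n. f (s * t) = of_int (l * n))" if f: "f \<in> coordinates" for f
  proof (rule ccontr)
    assume *: "\<not> ?thesis"
    have "\<exists>n. f x = of_int (l * n)" if "x \<in> A \<star> B" for x
      using that
    proof (induction rule: span_prod_induct)
      case (add s t)
      then obtain m n where "f s = of_int (l * m)" "f t = of_int (l * n)" by blast
      then have "f (s + t) = of_int (l * (m + n))" by (simp add: coordinate_hom[OF f] distrib_left)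
      then show ?case by blast
    qed (use * in blast)
    then obtain n where "f 1 = of_int (l * n)" using AB one_in_M11 by blast
    then have "l dvd 1"
      unfolding coordinate_hom(3)[OF f] by (metis dvd_triv_left of_int_1 of_int_eq_iff)
    then show False using l not_prime_unit by blast
  qed
  have dvd: "l dvd m * n \<longleftrightarrow> l dvd m \<or> l dvd n" for m n by (rule prime_dvd_mult_iff[OF l])
  have lr: "l dvd r" if "l dvd p" "l dvd q" using that by (simp add: r_eq)
  have lp: "l dvd p" if "l dvd r" "l dvd q" using that r_eq by (metis add_diff_cancel_right' dvd_diff)
  have lq: "l dvd q" if "l dvd r" "l dvd p" using that r_eq by (metis add_diff_cancel_left' dvd_diff)
  \<comment> \<open>If \<open>l\<close> divides neither \<open>p\<close> nor \<open>q\<close>, only the link \<open>r\<close> between the outer coordinates can matter.\<close>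
  define f where "f = (if l dvd p \<or> l dvd q then at_b else at_a)"
  have "f \<in> coordinates" by (simp add: f_def)
  then obtain s t where st: "s \<in> A" "t \<in> B" "\<not> (\<exists>n. f (s * t) = of_int (l * n))" using ex by blast
  obtain x y z x' y' z' where xyz: "s = int_triple x y z" "t = int_triple x' y' z'"
    using A B st(1,2) unfolding integral_def by metis
  have "int_triple (x * x') (y * y') (z * z') \<in> M 1 1"
    using span_prod_mult[OF st(1,2)] AB by (simp add: xyz)
  note cong = M11_congruences[OF this]
  have not: "\<not> l dvd (if l dvd p \<or> l dvd q then y * y' else x * x')"
  proof
    assume "l dvd (if l dvd p \<or> l dvd q then y * y' else x * x')"
    then obtain n where "(if l dvd p \<or> l dvd q then y * y' else x * x') = l * n" ..
    then have "f (s * t) = of_int (l * n)" unfolding f_def xyz by (auto split: if_splits simp flip: of_int_mult)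
    then show False using st(3) by blast
  qed
  have pc: "l dvd x * x' \<longleftrightarrow> l dvd y * y'" if "l dvd p"
    using dvd_trans[OF that cong(1)] by (metis diff_add_cancel dvd_add_right_iff)
  have qc: "l dvd y * y' \<longleftrightarrow> l dvd z * z'" if "l dvd q"
    using dvd_trans[OF that cong(2)] by (metis diff_add_cancel dvd_add_right_iff)
  have rc: "l dvd x * x' \<longleftrightarrow> l dvd z * z'" if "l dvd r"
    using dvd_trans[OF that cong(3)] by (metis diff_add_cancel dvd_add_right_iff)
  have not_y: "\<not> l dvd y * y'" if "l dvd p \<or> l dvd q" using not that by simp
  have not_x: "\<not> l dvd x * x'" if "l dvd r" using not that pc lp lq by (cases "l dvd p \<or> l dvd q") auto
  have "\<not> l dvd x" if "l dvd p \<or> l dvd r" using that not_x not_y pc by auto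
  moreover have "\<not> l dvd y" if "l dvd p \<or> l dvd q" using not_y[OF that] by auto
  moreover have "\<not> l dvd z" if "l dvd q \<or> l dvd r" using that not_x not_y qc rc by auto
  ultimately have "locally_unit l s"
    unfolding locally_unit_def xyz(1) dvd by blast
  then show ?thesis using st(1) by blast
qed

text \<open>
  Chinese remaindering, one prime at a time: if \<open>s\<close> is good for the primes in \<open>L\<close> and \<open>t\<close> is good for
  \<open>l0\<close>, then \<open>l0 s + P t\<close> with \<open>P\<close> the product of \<open>L\<close> is good for all of them.
\<close>

lemma semilocal_unit_exists:
  assumes mod: "R_module A" and ne: "A \<noteq> {}" and int: "integral A"
    and fin: "finite L" and prime: "\<And>l. l \<in> L \<Longrightarrow> Factorial_Ring.prime l"
    and local: "\<And>l. Factorial_Ring.prime l \<Longrightarrow> \<exists>s\<in>A. locally_unit l s"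
  shows "\<exists>s\<in>A. \<forall>l\<in>L. locally_unit l s"
  using fin prime
proof (induction L rule: finite_induct)
  case empty
  with ne show ?case by blast
next
  case (insert l0 L)
  then obtain s where s: "s \<in> A" "\<forall>l\<in>L. locally_unit l s" by auto
  have l0: "Factorial_Ring.prime l0" using insert.prems by blast
  obtain t where t: "t \<in> A" "locally_unit l0 t" using local[OF l0] by blast
  define P where "P = \<Prod>L"
  obtain x y z where s_eq: "s = int_triple x y z" using s(1) int unfolding integral_def by blast
  obtain x' y' z' where t_eq: "t = int_triple x' y' z'" using t(1) int unfolding integral_def by blast
  have P: "l dvd P" if "l \<in> L" for l unfolding P_def using insert.hyps(1) that by (rule dvd_prodI)
  have nP: "\<not> l0 dvd P"
  proof
    assume "l0 dvd P"
    then obtain l where "l \<in> L" "l0 dvd l"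
      unfolding P_def using prime_dvd_prod_iff[OF insert.hyps(1) l0, of "\<lambda>l. l"] by auto
    then have "l0 = l" using l0 insert.prems by (intro primes_dvd_imp_eq) auto
    then show False using \<open>l \<in> L\<close> insert.hyps(2) by simp
  qed
  have old: "l dvd l0 * m + P * n \<longleftrightarrow> l dvd m" if l: "l \<in> L" for l m n
  proof -
    have "l dvd l0 * m + P * n \<longleftrightarrow> l dvd l0 * m" using P[OF l] by (simp add: dvd_add_left_iff)
    also have "\<dots> \<longleftrightarrow> l dvd m"
    proof -
      have "Factorial_Ring.prime l" using l insert.prems by blast
      moreover have "\<not> l dvd l0"
        using l insert.hyps(2) primes_dvd_imp_eq[OF calculation l0] by blast
      ultimately show ?thesis by (simp add: prime_dvd_mult_iff)
    qed
    finally show ?thesis .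
  qed
  have new: "l0 dvd l0 * m + P * n \<longleftrightarrow> l0 dvd n" for m n
    using nP l0 by (simp add: dvd_add_right_iff prime_dvd_mult_iff)
  have "int_triple l0 l0 l0 * s + int_triple P P P * t \<in> A"
    by (intro R_module_add[OF mod] R_module_int_mult[OF mod] s t)
  moreover have "locally_unit l (int_triple l0 l0 l0 * s + int_triple P P P * t)" if "l \<in> insert l0 L" for l
  proof (cases "l \<in> L")
    case True
    then show ?thesis using s(2) by (simp add: locally_unit_def s_eq t_eq old)
  next
    case False
    with that have "l = l0" by simp
    then show ?thesis using t(2) by (simp add: locally_unit_def s_eq t_eq new)
  qed
  ultimately show ?case by blast
qed

text \<open>
  A primitive ideal absorbs the conductor, because a conductor element supported in one coordinate
  sends any element with coordinate \<open>1\<close> there to the conductor element.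
\<close>

lemma M_subset_if_generator:
  assumes A: "R_module A" "primitive A" and gen: "int_triple u 1 w \<in> A" and w: "q * r dvd v * w - 1"
  shows "M u v \<subseteq> A"
proof
  fix t assume "t \<in> M u v"
  then obtain x y z j where t: "t = int_triple x y z"
    and x: "p * r dvd x - u * (y - p * j)" and z: "q * r dvd v * z - (y + q * j)" by (rule M_cases)
  from x obtain k where k: "x - u * (y - p * j) = p * r * k" ..
  have "q * r dvd w * (v * z - (y + q * j)) - (v * w - 1) * z"
    by (rule dvd_diff[OF dvd_mult[OF z] dvd_mult2[OF w]])
  also have "w * (v * z - (y + q * j)) - (v * w - 1) * z = z - w * (y + q * j)"
    by (simp add: algebra_simps)
  finally obtain l where l: "z - w * (y + q * j) = q * r * l" ..
  obtain s s' where s: "s \<in> A" "at_a s = 1" and s': "s' \<in> A" "at_c s' = 1"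
    using A(2) unfolding primitive_def by (meson insertCI)
  have "int_triple (y - p * j) y (y + q * j) \<in> M 1 1"
    unfolding int_triple_in_M by (rule exI[of _ j]) simp
  then have "int_triple (y - p * j) y (y + q * j) * int_triple u 1 w + (int_triple (p * r * k) 0 0 * s
      + int_triple 0 0 (q * r * l) * s') \<in> A"
    using conductor_in_M[of k 0 1 1] conductor_in_M[of 0 l 1 1]
    by (intro R_module_add[OF A(1)] R_module_mult[OF A(1)] gen s s') simp_all
  moreover have "int_triple (p * r * k) 0 0 * s = int_triple (p * r * k) 0 0"
    "int_triple 0 0 (q * r * l) * s' = int_triple 0 0 (q * r * l)"
    using s s' by (cases s; cases s'; simp add: int_triple_def)+
  moreover have "x = (y - p * j) * u + p * r * k" "z = (y + q * j) * w + q * r * l"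
    using k l by (simp_all add: algebra_simps)
  ultimately show "t \<in> A" unfolding t by simp
qed

text \<open>
  Multiplying by a scalar that inverts the middle coordinate modulo \<open>p q\<close>, and is prime to all of
  \<open>p q r\<close>, makes that coordinate congruent to \<open>1\<close>; the remaining multiple of \<open>p q\<close> is removed by an element
  of the conductor.
\<close>

lemma normalized_generator_exists:
  assumes A: "R_module A" "integral A" "primitive A" and B: "integral B" and AB: "A \<star> B = M 1 1"
  obtains u w where "coprime u (p * r)" "coprime w (q * r)" "int_triple u 1 w \<in> A"
proof -
  have nz: "p \<noteq> 0" "q \<noteq> 0" "r \<noteq> 0" using p_pos q_pos r_eq by auto
  have "A \<noteq> {}" using A(3) unfolding primitive_def by blast
  then have "\<exists>s\<in>A. \<forall>l\<in>prime_factors (p * q * r). locally_unit l s"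
    by (rule semilocal_unit_exists[OF A(1) _ A(2)])
      (use local_unit_exists[OF A(2) B AB] in \<open>auto simp: in_prime_factors_iff\<close>)
  then obtain s where s: "s \<in> A" and unit: "\<And>l. l \<in> prime_factors (p * q * r) \<Longrightarrow> locally_unit l s" by blast
  obtain x y z where xyz: "s = int_triple x y z" using s A(2) unfolding integral_def by blast
  have unit: "(l dvd p * r \<longrightarrow> \<not> l dvd x) \<and> (l dvd p * q \<longrightarrow> \<not> l dvd y) \<and> (l dvd q * r \<longrightarrow> \<not> l dvd z)"
    if "Factorial_Ring.prime l" for l
  proof (cases "l dvd p * q * r")
    case True
    then have "l \<in> prime_factors (p * q * r)" using that nz by (simp add: in_prime_factors_iff)
    from unit[OF this] show ?thesis unfolding locally_unit_def xyz by simp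
  next
    case False
    then show ?thesis using that by (auto simp: prime_dvd_mult_iff)
  qed
  have x: "coprime x (p * r)" by (rule coprime_if_no_common_prime) (use nz unit in auto)
  have y: "coprime y (p * q)" by (rule coprime_if_no_common_prime) (use nz unit in auto)
  have z: "coprime z (q * r)" by (rule coprime_if_no_common_prime) (use nz unit in auto)
  obtain n where n: "p * q dvd n * y - 1" "coprime n (p * q * r)"
    using coprime_inverse_lift[OF y, of "p * q * r"] nz by auto
  from n(1) obtain k where k: "n * y - 1 = p * q * k" ..
  obtain t where t: "t \<in> A" "at_b t = 1" using A(3) unfolding primitive_def by (meson insertCI)
  have "int_triple n n n * s + int_triple 0 (p * q * (- k)) 0 * t \<in> A"
    by (intro R_module_add[OF A(1)] R_module_int_mult[OF A(1)] R_module_mult[OF A(1)] s t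
        conductor_mid_in_M)
  moreover have "int_triple 0 (p * q * (- k)) 0 * t = int_triple 0 (p * q * (- k)) 0"
    using t(2) by (cases t) (simp add: int_triple_def)
  moreover have "n * y + p * q * (- k) = 1" using k by simp
  ultimately have "int_triple (n * x) 1 (n * z) \<in> A" by (simp add: xyz)
  moreover have "coprime n p" "coprime n q" "coprime n r" using n(2) by simp_all
  ultimately show thesis using x z by (intro that[of "n * x" "n * z"]) auto
qed

text \<open>
  The ideal contains some \<open>M u v\<close>. Multiplying by the inverse of \<open>M u v\<close> yields an invertible ideal inside
  \<open>\<int>\<^sup>3\<close> that contains \<open>1\<close>, so the rigidity principle identifies it with \<open>R\<close>.
\<close>

lemma primitive_ideal_eq_M:
  assumes A: "R_module A" "integral A" "primitive A" and B: "R_module B" and AB: "A \<star> B = M 1 1"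
  obtains u v where "coprime u (p * r)" "coprime v (q * r)" "A = M u v"
proof -
  have intB: "integral B" by (rule cofactor_integral[OF A(3) AB])
  obtain u w where u: "coprime u (p * r)" and w: "coprime w (q * r)" and uw: "int_triple u 1 w \<in> A"
    using normalized_generator_exists[OF A intB AB] .
  obtain v where v: "q * r dvd w * v - 1" "coprime v (q * r)" using unit_inverse[OF w] .
  obtain u' where u': "p * r dvd u * u' - 1" using unit_inverse[OF u] .
  have sub: "M u v \<subseteq> A"
    by (rule M_subset_if_generator[OF A(1,3) uw]) (use v in \<open>simp add: mult.commute\<close>)
  have inv: "M u v \<star> M u' w = M 1 1"
    using M_mult_inverse[OF u', of v w] v by (simp add: mult.commute)
  have "M u' w \<star> A = M 1 1"
  proof (rule ideal_eq_R_if_one)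
    show "R_module (M u' w \<star> A)" "R_module (M u v \<star> B)"
      by (intro R_module_span_prod R_module_M)+
    show "integral (M u' w \<star> A)" by (intro integral_span_prod integral_M A(2))
    have "M u' w \<star> M u v \<subseteq> M u' w \<star> A"
      by (rule span_prod_subsetI[OF span_prod_mult span_prod_add]) (use sub in auto)
    then show "1 \<in> M u' w \<star> A" using inv one_in_M11 by (auto simp only: span_prod_commute)
    have "(M u' w \<star> A) \<star> (M u v \<star> B) = (M u v \<star> M u' w) \<star> (A \<star> B)"
      by (simp only: span_prod_ac)
    then show "(M u' w \<star> A) \<star> (M u v \<star> B) = M 1 1"
      using inv AB span_prod_M11[OF R_module_M] by simp
  qed
  then have "M u v \<star> (M u' w \<star> A) = M u v"
    using span_prod_M11[OF R_module_M, of u v] by (simp only: span_prod_commute)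
  moreover have "M u v \<star> (M u' w \<star> A) = A"
    unfolding span_prod_assoc[symmetric] inv by (rule span_prod_M11[OF A(1)])
  ultimately have "A = M u v" by simp
  then show thesis using that u v(2) by blast
qed

lemma invertible_R_module_cases:
  assumes "R_module A" "R_module B" "A \<star> B = M 1 1"
  obtains k k' u v where "k * k' = 1" "coprime u (p * r)" "coprime v (q * r)" "(\<lambda>s. k * s) ` A = M u v"
proof -
  obtain k k' where k: "k * k' = 1" "integral ((\<lambda>s. k * s) ` A)" "primitive ((\<lambda>s. k * s) ` A)"
    "(\<lambda>s. k * s) ` A \<star> (\<lambda>s. k' * s) ` B = M 1 1"
    using primitive_scaling[OF assms] .
  obtain u v where "coprime u (p * r)" "coprime v (q * r)" "(\<lambda>s. k * s) ` A = M u v"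
    by (rule primitive_ideal_eq_M[OF R_module_scale[OF assms(1)] k(2,3) R_module_scale[OF assms(2)] k(4)])
  then show thesis by (rule that[OF k(1)])
qed

section \<open>Transport to the residue class algebra\<close>

abbreviation K :: "rat poly set ring"
  where "K \<equiv> alg_K\<^sub>0 a b c"

abbreviation residue_class :: "rat poly \<Rightarrow> rat poly set"
  where "residue_class f \<equiv> PIdl\<^bsub>polys\<^esub> (chi a b c) +>\<^bsub>polys\<^esub> f"

definition values_at_roots :: "rat poly \<Rightarrow> triple"
  where "values_at_roots f = Triple (poly f (of_int a)) (poly f (of_int b)) (poly f (of_int c))"

lemma values_at_roots_hom:
  "values_at_roots (f + g) = values_at_roots f + values_at_roots g"
  "values_at_roots (f - g) = values_at_roots f - values_at_roots g"
  "values_at_roots (f * g) = values_at_roots f * values_at_roots g"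
  "values_at_roots 1 = 1" "values_at_roots 0 = 0"
  by (simp_all add: values_at_roots_def one_triple_def zero_triple_def)

lemma chi_dvd_iff: "chi a b c dvd f \<longleftrightarrow> values_at_roots f = 0"
proof
  assume "chi a b c dvd f"
  then obtain g where g: "f = chi a b c * g" ..
  show "values_at_roots f = 0"
    unfolding g values_at_roots_def zero_triple_def chi_def poly_mult by simp
next
  assume "values_at_roots f = 0"
  then have f: "poly f (of_int a) = 0" "poly f (of_int b) = 0" "poly f (of_int c) = 0"
    by (simp_all add: values_at_roots_def zero_triple_def)
  from f(1) obtain g where g: "f = [:- of_int a, 1:] * g" by (auto simp: poly_eq_0_iff_dvd)
  have "poly g (of_int b) = 0" "poly g (of_int c) = 0" using f(2,3) ab bc unfolding g by auto
  then obtain h where h: "g = [:- of_int b, 1:] * h" by (auto simp: poly_eq_0_iff_dvd)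
  have "poly h (of_int c) = 0" using \<open>poly g (of_int c) = 0\<close> bc unfolding h by auto
  then obtain k where k: "h = [:- of_int c, 1:] * k" by (auto simp: poly_eq_0_iff_dvd)
  have "f = chi a b c * k" unfolding g h k chi_def by (simp only: mult.assoc)
  then show "chi a b c dvd f" by simp
qed

lemma residue_class_eq_iff: "residue_class f = residue_class g \<longleftrightarrow> values_at_roots f = values_at_roots g"
  unfolding coset_eq_iff chi_dvd_iff values_at_roots_hom by simp

definition lagrange :: "triple \<Rightarrow> rat poly"
  where "lagrange t =
    smult (at_a t / (of_int (a - b) * of_int (a - c))) ([:- of_int b, 1:] * [:- of_int c, 1:]) +
    smult (at_b t / (of_int (b - a) * of_int (b - c))) ([:- of_int a, 1:] * [:- of_int c, 1:]) +
    smult (at_c t / (of_int (c - a) * of_int (c - b))) ([:- of_int a, 1:] * [:- of_int b, 1:])"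

lemma values_lagrange: "values_at_roots (lagrange t) = t"
proof -
  have "of_int b - of_int a \<noteq> (0::rat)" "of_int a - of_int b \<noteq> (0::rat)"
    "of_int c - of_int a \<noteq> (0::rat)" "of_int a - of_int c \<noteq> (0::rat)"
    "of_int c - of_int b \<noteq> (0::rat)" "of_int b - of_int c \<noteq> (0::rat)"
    using ab bc by auto
  then show ?thesis
    unfolding values_at_roots_def lagrange_def poly_add poly_smult poly_mult by (cases t) simp
qed

text \<open>
  The isomorphism from \<open>\<rat>\<^sup>3\<close> to \<open>\<rat>[x]/(\<chi>)\<close>, total on the type of triples; evaluation at the roots is its
  inverse.
\<close>

definition \<tau> :: "triple \<Rightarrow> rat poly set"
  where "\<tau> t = residue_class (lagrange t)"

lemma \<tau>_values: "\<tau> (values_at_roots f) = residue_class f"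
  unfolding \<tau>_def residue_class_eq_iff values_lagrange ..

lemma inj_\<tau>: "inj \<tau>"
  by (rule injI) (simp add: \<tau>_def residue_class_eq_iff values_lagrange)

lemma \<tau>_eq_iff [simp]: "\<tau> s = \<tau> t \<longleftrightarrow> s = t"
  using inj_\<tau> by (simp add: inj_eq)

lemma carrier_K: "carrier K = range \<tau>"
  unfolding carrier_alg_K\<^sub>0
proof
  show "range residue_class \<subseteq> range \<tau>" by (metis \<tau>_values image_subsetI rangeI)
  show "range \<tau> \<subseteq> range residue_class" by (auto simp: \<tau>_def)
qed

lemma \<tau>_closed [simp]: "\<tau> t \<in> carrier K"
  by (simp add: carrier_K)

lemma residue_class_hom: "residue_class \<in> ring_hom polys K"
  unfolding alg_K\<^sub>0_def by (rule ideal.rcos_ring_hom[OF ideal_chi])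

lemma \<tau>_mult: "\<tau> s \<otimes>\<^bsub>K\<^esub> \<tau> t = \<tau> (s * t)"
proof -
  have "\<tau> s \<otimes>\<^bsub>K\<^esub> \<tau> t = residue_class (lagrange s * lagrange t)"
    unfolding \<tau>_def using ring_hom_mult[OF residue_class_hom, of "lagrange s" "lagrange t"]
    by (simp add: ring_of_type_algebra_def)
  then show ?thesis by (simp add: values_at_roots_hom values_lagrange flip: \<tau>_values)
qed

lemma \<tau>_add: "\<tau> s \<oplus>\<^bsub>K\<^esub> \<tau> t = \<tau> (s + t)"
proof -
  have "\<tau> s \<oplus>\<^bsub>K\<^esub> \<tau> t = residue_class (lagrange s + lagrange t)"
    unfolding \<tau>_def using ring_hom_add[OF residue_class_hom, of "lagrange s" "lagrange t"]
    by (simp add: ring_of_type_algebra_def)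
  then show ?thesis by (simp add: values_at_roots_hom values_lagrange flip: \<tau>_values)
qed

lemma \<tau>_one: "\<one>\<^bsub>K\<^esub> = \<tau> 1"
proof -
  have "\<one>\<^bsub>K\<^esub> = residue_class 1"
    using ring_hom_one[OF residue_class_hom] by (simp add: ring_of_type_algebra_def)
  then show ?thesis by (simp add: values_at_roots_hom flip: \<tau>_values)
qed

lemma \<tau>_zero: "\<zero>\<^bsub>K\<^esub> = \<tau> 0"
proof -
  interpret K: cring K by (rule cring_alg_K\<^sub>0)
  have "\<tau> 0 \<oplus>\<^bsub>K\<^esub> \<tau> 0 = \<tau> 0" by (simp add: \<tau>_add)
  then show ?thesis using K.add.r_cancel_one' by (metis \<tau>_closed)
qed

lemma \<tau>_Units: "s * t = 1 \<Longrightarrow> \<tau> s \<in> Units K"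
proof -
  assume "s * t = 1"
  then have "\<tau> s \<otimes>\<^bsub>K\<^esub> \<tau> t = \<one>\<^bsub>K\<^esub>" "\<tau> t \<otimes>\<^bsub>K\<^esub> \<tau> s = \<one>\<^bsub>K\<^esub>"
    by (simp_all add: \<tau>_mult \<tau>_one mult.commute)
  then show ?thesis unfolding Units_def using \<tau>_closed by blast
qed

lemma \<tau>_image_cases: "I \<subseteq> carrier K \<Longrightarrow> \<exists>A. I = \<tau> ` A"
  unfolding carrier_K by (metis subset_image_iff)

lemma \<tau>_image_eq_iff [simp]: "\<tau> ` A = \<tau> ` B \<longleftrightarrow> A = B"
  by (rule inj_image_eq_iff[OF inj_\<tau>])

lemma \<tau>_scale: "\<tau> k <#\<^bsub>K\<^esub> (\<tau> ` A) = \<tau> ` (\<lambda>s. k * s) ` A"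
  unfolding l_coset_image image_image by (simp add: \<tau>_mult)

lemma \<tau>_span_prod: "ideal_prod K (\<tau> ` A) (\<tau> ` B) = \<tau> ` (A \<star> B)"
proof
  show "ideal_prod K (\<tau> ` A) (\<tau> ` B) \<subseteq> \<tau> ` (A \<star> B)"
  proof
    fix x assume "x \<in> ideal_prod K (\<tau> ` A) (\<tau> ` B)"
    then show "x \<in> \<tau> ` (A \<star> B)"
      by induction (auto simp: \<tau>_mult \<tau>_add intro!: imageI span_prod_mult span_prod_add)
  qed
  show "\<tau> ` (A \<star> B) \<subseteq> ideal_prod K (\<tau> ` A) (\<tau> ` B)"
  proof clarify
    fix s assume "s \<in> A \<star> B"
    then show "\<tau> s \<in> ideal_prod K (\<tau> ` A) (\<tau> ` B)"
      by (induction rule: span_prod_induct)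
        (auto simp flip: \<tau>_mult \<tau>_add intro: ideal_prod.intros)
  qed
qed

lemma poly_map_poly_of_int: "poly (map_poly rat_of_int f) (of_int x) = of_int (poly f x)"
  by (induction f) (simp_all add: map_poly_pCons)

lemma values_of_int_poly:
  "values_at_roots (map_poly rat_of_int f) = int_triple (poly f a) (poly f b) (poly f c)"
  by (simp add: values_at_roots_def int_triple_def poly_map_poly_of_int)

lemma poly_linear_quotient: "\<exists>g. f = [:poly f x:] + [:- x, 1:] * g" for f :: "int poly"
proof -
  have "poly (f - [:poly f x:]) x = 0" by simp
  then obtain g where "f - [:poly f x:] = [:- x, 1:] * g" unfolding poly_eq_0_iff_dvd by (rule dvdE)
  then have "f = [:poly f x:] + [:- x, 1:] * g" by (simp only: diff_eq_eq add.commute)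
  then show ?thesis by blast
qed

text \<open>
  Newton interpolation: modulo \<open>\<chi>\<close> an integer polynomial is
  \<open>y + (x - b) (j + (x - c) k + (x - a) l)\<close>, whose value at \<open>a\<close> is \<open>y - p j + p r k\<close> and whose value at \<open>c\<close>
  is \<open>y + q j + q r l\<close>.
\<close>

lemma values_of_int_polys:
  "range (\<lambda>f. int_triple (poly f a) (poly f b) (poly f c)) = M 1 1"
proof
  show "range (\<lambda>f. int_triple (poly f a) (poly f b) (poly f c)) \<subseteq> M 1 1"
  proof clarify
    fix f :: "int poly"
    obtain g where g: "f = [:poly f b:] + [:- b, 1:] * g" using poly_linear_quotient by blast
    obtain h where h: "g = [:poly g a:] + [:- a, 1:] * h" using poly_linear_quotient by blast
    have f: "poly f x = poly f b + (x - b) * poly g x" for x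
      using arg_cong[OF g, of "\<lambda>f. poly f x"] by (simp add: algebra_simps)
    have h: "poly g x = poly g a + (x - a) * poly h x" for x
      using arg_cong[OF h, of "\<lambda>g. poly g x"] by (simp add: algebra_simps)
    have "poly f a - 1 * (poly f b - p * poly g a) = 0"
      using f[of a] by (simp add: p_def algebra_simps)
    moreover have "1 * poly f c - (poly f b + q * poly g a) = q * r * poly h c"
      unfolding f[of c] h[of c] by (simp add: q_def r_def algebra_simps)
    ultimately have "p * r dvd poly f a - 1 * (poly f b - p * poly g a)"
      "q * r dvd 1 * poly f c - (poly f b + q * poly g a)" by simp_all
    then show "int_triple (poly f a) (poly f b) (poly f c) \<in> M 1 1"
      unfolding int_triple_in_M by blast
  qed
  show "M 1 1 \<subseteq> range (\<lambda>f. int_triple (poly f a) (poly f b) (poly f c))"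
  proof
    fix t assume "t \<in> M 1 1"
    then obtain x y z j where t: "t = int_triple x y z"
      and "p * r dvd x - 1 * (y - p * j)" "q * r dvd 1 * z - (y + q * j)" by (rule M_cases)
    then obtain k l where k: "x - 1 * (y - p * j) = p * r * k" and l: "1 * z - (y + q * j) = q * r * l"
      by (auto elim!: dvdE)
    \<comment> \<open>The coefficients of the Newton form are read off from the congruences.\<close>
    define f where "f = [:y:] + [:- b, 1:] * ([:j:] + [:- c, 1:] * [:k:] + [:- a, 1:] * [:l:])"
    have "poly f a = x" "poly f b = y" "poly f c = z"
      using k l by (simp_all add: f_def p_def q_def r_def algebra_simps)
    then show "t \<in> range (\<lambda>f. int_triple (poly f a) (poly f b) (poly f c))"
      unfolding t by (intro range_eqI[of _ _ f]) simp
  qed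
qed

lemma image_R_to_K\<^sub>0: "R_to_K\<^sub>0 a b c ` carrier (order_R a b c) = \<tau> ` M 1 1"
  unfolding carrier_order_R values_of_int_polys[symmetric] image_image
  by (simp add: R_to_K\<^sub>0_coset flip: \<tau>_values values_of_int_poly)

lemma R_module_if_fractional_ideal:
  assumes "fractional_ideal a b c (\<tau> ` A)"
  shows "R_module A"
proof -
  have sub: "subgroup (\<tau> ` A) (add_monoid K)"
    and mult: "\<And>r x. r \<in> R_to_K\<^sub>0 a b c ` carrier (order_R a b c) \<Longrightarrow> x \<in> \<tau> ` A \<Longrightarrow> r \<otimes>\<^bsub>K\<^esub> x \<in> \<tau> ` A"
    using assms unfolding fractional_ideal_iff by auto
  have mem: "\<tau> s \<in> \<tau> ` A \<longleftrightarrow> s \<in> A" for s A by auto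
  have "s + t \<in> A" if "s \<in> A" "t \<in> A" for s t
    using subgroup.m_closed[OF sub, of "\<tau> s" "\<tau> t"] that by (simp add: \<tau>_add mem)
  moreover have "s * t \<in> A" if "s \<in> M 1 1" "t \<in> A" for s t
    using mult[of "\<tau> s" "\<tau> t"] that by (simp add: \<tau>_mult mem image_R_to_K\<^sub>0)
  ultimately show ?thesis unfolding R_module_def by blast
qed

text \<open>
  A basis, triangular with respect to the coordinates taken in the order second, first, third:
  \<open>(u, 1, v')\<close>, \<open>(p, 0, - q v' u')\<close> and \<open>(0, 0, q r)\<close>. An element with middle coordinate \<open>0\<close> has first
  coordinate \<open>- u p j\<close> modulo \<open>p r\<close>, which equals \<open>p\<close> for \<open>j = - u'\<close>; this determines the second vector.
\<close>

lemma M_triangular_basis: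
  assumes u: "p * r dvd u * u' - 1" and v: "q * r dvd v * v' - 1"
  shows "M u v = {int_triple (u * l + p * m) l (v' * l - q * v' * u' * m + q * r * n) | l m n. True}"
    (is "_ = ?B")
proof
  from u obtain k where k: "u * u' - 1 = p * r * k" ..
  from v obtain k' where k': "v * v' - 1 = q * r * k'" ..
  show "M u v \<subseteq> ?B"
  proof
    fix t assume "t \<in> M u v"
    then obtain x y z j where t: "t = int_triple x y z"
      and x: "p * r dvd x - u * (y - p * j)" and z: "q * r dvd v * z - (y + q * j)" by (rule M_cases)
    from x obtain i where i: "x - u * (y - p * j) = p * r * i" ..
    from z obtain h where h: "v * z - (y + q * j) = q * r * h" ..
    define m where "m = r * i - u * j"
    define n where "n = v' * h - k' * z + v' * u' * i - v' * p * k * j"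
    have "u * y + p * m = x" using i by (simp add: m_def algebra_simps)
    moreover have "v' * y - q * v' * u' * m + q * r * n = z"
    proof -
      have "z - v' * y + q * v' * u' * m =
          v' * (v * z - (y + q * j)) - (v * v' - 1) * z + q * r * (v' * u' * i) - q * v' * j * (u * u' - 1)"
        by (simp add: m_def algebra_simps)
      then show ?thesis unfolding h k k' by (simp add: n_def algebra_simps)
    qed
    ultimately have "t = int_triple (u * y + p * m) y (v' * y - q * v' * u' * m + q * r * n)"
      unfolding t by simp
    then show "t \<in> ?B" by blast
  qed
  show "?B \<subseteq> M u v"
  proof clarify
    fix l m n
    have "u * l + p * m - u * (l - p * (- (u' * m))) = p * r * (- p * k * m)"
    proof -
      have "u * l + p * m - u * (l - p * (- (u' * m))) = - (p * m * (u * u' - 1))"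
        by (simp add: algebra_simps)
      then show ?thesis unfolding k by (simp add: algebra_simps)
    qed
    moreover have "v * (v' * l - q * v' * u' * m + q * r * n) - (l + q * (- (u' * m))) =
        q * r * (k' * l - q * u' * k' * m + v * n)"
    proof -
      have "v * (v' * l - q * v' * u' * m + q * r * n) - (l + q * (- (u' * m))) =
          (v * v' - 1) * (l - q * u' * m) + q * r * (v * n)"
        by (simp add: algebra_simps)
      then show ?thesis unfolding k' by (simp add: algebra_simps)
    qed
    ultimately show "int_triple (u * l + p * m) l (v' * l - q * v' * u' * m + q * r * n) \<in> M u v"
      unfolding int_triple_in_M by (metis dvd_triv_left)
  qed
qed

lemma add_monoid_M_free:
  assumes u: "coprime u (p * r)" and v: "coprime v (q * r)"
    and grp: "group (add_monoid K\<lparr>carrier := \<tau> ` M u v\<rparr>)"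
  shows "add_monoid K\<lparr>carrier := \<tau> ` M u v\<rparr> \<cong> free_Abelian_group {..<3::nat}"
proof -
  obtain u' where u': "p * r dvd u * u' - 1" using unit_inverse[OF u] by blast
  obtain v' where v': "q * r dvd v * v' - 1" using unit_inverse[OF v] by blast
  define basis where "basis l m n =
    int_triple (u * l + p * m) l (v' * l - q * v' * u' * m + q * r * n)" for l m n
  have M: "M u v = {basis l m n | l m n. True}"
    unfolding basis_def by (rule M_triangular_basis[OF u' v'])
  have inj: "l = l' \<and> m = m' \<and> n = n'" if "basis l m n = basis l' m' n'" for l m n l' m' n'
  proof -
    have "l = l'" using that by (simp add: basis_def)
    moreover from this have "m = m'" using that p_pos by (simp add: basis_def)
    moreover from calculation have "n = n'" using that q_pos p_pos r_eq by (simp add: basis_def)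
    ultimately show ?thesis by simp
  qed
  define h where "h f = \<tau> (basis (Poly_Mapping.lookup f 0) (Poly_Mapping.lookup f 1) (Poly_Mapping.lookup f 2))"
    for f :: "nat \<Rightarrow>\<^sub>0 int"
  have "h \<in> iso (free_Abelian_group {..<3}) (add_monoid K\<lparr>carrier := \<tau> ` M u v\<rparr>)"
  proof (rule isoI)
    show "h \<in> hom (free_Abelian_group {..<3}) (add_monoid K\<lparr>carrier := \<tau> ` M u v\<rparr>)"
    proof (rule homI)
      fix f :: "nat \<Rightarrow>\<^sub>0 int"
      show "h f \<in> carrier (add_monoid K\<lparr>carrier := \<tau> ` M u v\<rparr>)" by (auto simp: h_def M)
    next
      fix f g :: "nat \<Rightarrow>\<^sub>0 int"
      show "h (f \<otimes>\<^bsub>free_Abelian_group {..<3}\<^esub> g) =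
          h f \<otimes>\<^bsub>add_monoid K\<lparr>carrier := \<tau> ` M u v\<rparr>\<^esub> h g"
        by (simp add: h_def \<tau>_add basis_def lookup_add algebra_simps)
    qed
    show "bij_betw h (carrier (free_Abelian_group {..<3})) (carrier (add_monoid K\<lparr>carrier := \<tau> ` M u v\<rparr>))"
      unfolding bij_betw_def
    proof
      show "inj_on h (carrier (free_Abelian_group {..<3}))"
      proof (rule inj_onI)
        fix f g :: "nat \<Rightarrow>\<^sub>0 int"
        assume f: "f \<in> carrier (free_Abelian_group {..<3})" and g: "g \<in> carrier (free_Abelian_group {..<3})"
          and eq: "h f = h g"
        from eq have eq: "Poly_Mapping.lookup f i = Poly_Mapping.lookup g i" if "i \<in> {0, 1, 2}" for i
          using that unfolding h_def \<tau>_eq_iff by (auto dest: inj)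
        show "f = g"
        proof (rule poly_mapping_eqI)
          fix i
          show "Poly_Mapping.lookup f i = Poly_Mapping.lookup g i"
          proof (cases "i < 3")
            case True
            then show ?thesis using eq[of i] by force
          next
            case False
            then have "i \<notin> Poly_Mapping.keys f" "i \<notin> Poly_Mapping.keys g" using f g by auto
            then show ?thesis by (simp add: in_keys_iff)
          qed
        qed
      qed
      show "h ` carrier (free_Abelian_group {..<3}) = carrier (add_monoid K\<lparr>carrier := \<tau> ` M u v\<rparr>)"
      proof
        show "h ` carrier (free_Abelian_group {..<3}) \<subseteq> carrier (add_monoid K\<lparr>carrier := \<tau> ` M u v\<rparr>)"
          by (auto simp: h_def M)
        show "carrier (add_monoid K\<lparr>carrier := \<tau> ` M u v\<rparr>) \<subseteq> h ` carrier (free_Abelian_group {..<3})"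
        proof
          fix x assume "x \<in> carrier (add_monoid K\<lparr>carrier := \<tau> ` M u v\<rparr>)"
          then obtain l m n where x: "x = \<tau> (basis l m n)" unfolding M by auto
          define f where "f = Poly_Mapping.single (0::nat) l + Poly_Mapping.single 1 m + Poly_Mapping.single 2 n"
          have "Poly_Mapping.keys f \<subseteq> {..<3}"
            by (auto simp: f_def in_keys_iff lookup_add lookup_single when_def split: if_splits)
          moreover have "h f = x" by (simp add: h_def f_def x lookup_add lookup_single when_def)
          ultimately show "x \<in> h ` carrier (free_Abelian_group {..<3})"
            by (intro image_eqI[of _ _ f]) simp_all
        qed
      qed
    qed
  qed
  then show ?thesis
    using group.iso_sym[OF group_free_Abelian_group] is_isoI by blast
qed

lemma fractional_ideal_M:
  assumes u: "coprime u (p * r)" and v: "coprime v (q * r)"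
  shows "fractional_ideal a b c (\<tau> ` M u v)"
proof -
  interpret K: cring K by (rule cring_alg_K\<^sub>0)
  have sub: "subgroup (\<tau> ` M u v) (add_monoid K)"
  proof (rule K.add.subgroupI)
    show "\<tau> ` M u v \<subseteq> carrier K" by auto
    show "\<tau> ` M u v \<noteq> {}" using conductor_in_M by blast
    show "\<ominus>\<^bsub>K\<^esub> x \<in> \<tau> ` M u v" if "x \<in> \<tau> ` M u v" for x
    proof -
      from that obtain s where s: "s \<in> M u v" "x = \<tau> s" by blast
      have "\<tau> (- s) \<oplus>\<^bsub>K\<^esub> \<tau> s = \<zero>\<^bsub>K\<^esub>" by (simp add: \<tau>_add \<tau>_zero)
      then have "\<ominus>\<^bsub>K\<^esub> x = \<tau> (- s)" unfolding s(2) by (intro K.minus_equality) simp_all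
      moreover have "- s = int_triple (- 1) (- 1) (- 1) * s"
        by (cases s) (simp add: int_triple_def)
      ultimately show ?thesis using R_module_int_mult[OF R_module_M s(1), of "- 1"] by auto
    qed
    show "x \<oplus>\<^bsub>K\<^esub> y \<in> \<tau> ` M u v" if "x \<in> \<tau> ` M u v" "y \<in> \<tau> ` M u v" for x y
      using that by (auto simp: \<tau>_add intro!: imageI M_add)
  qed
  have mult: "R_to_K\<^sub>0 a b c r \<otimes>\<^bsub>K\<^esub> x \<in> \<tau> ` M u v"
    if "r \<in> carrier (order_R a b c)" "x \<in> \<tau> ` M u v" for r x
  proof -
    have "R_to_K\<^sub>0 a b c r \<in> \<tau> ` M 1 1" unfolding image_R_to_K\<^sub>0[symmetric] using that(1) by blast
    then show ?thesis using that(2) by (auto simp: \<tau>_mult intro!: imageI R_module_mult[OF R_module_M])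
  qed
  show ?thesis
    unfolding fractional_ideal_iff
    using sub mult add_monoid_M_free[OF u v] subgroup.subgroup_is_group[OF sub K.a_group] by blast
qed

section \<open>The class group\<close>

definition M_class :: "int \<Rightarrow> int \<Rightarrow> rat poly set set set"
  where "M_class u v = ideal_equiv a b c `` {\<tau> ` M u v}"

lemma invertible_M:
  assumes u: "coprime u (p * r)" and v: "coprime v (q * r)"
  shows "invertible_ideal a b c (\<tau> ` M u v)"
proof -
  obtain u' where u': "p * r dvd u * u' - 1" "coprime u' (p * r)" using unit_inverse[OF u] .
  obtain v' where v': "q * r dvd v * v' - 1" "coprime v' (q * r)" using unit_inverse[OF v] .
  show ?thesis
    unfolding invertible_ideal_def
    using fractional_ideal_M[OF u v] fractional_ideal_M[OF u'(2) v'(2)] M_mult_inverse[OF u'(1) v'(1)]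
    by (auto simp: \<tau>_span_prod image_R_to_K\<^sub>0 intro!: exI[of _ "\<tau> ` M u' v'"])
qed

lemma M_class_mult:
  assumes "coprime u (p * r)" "coprime v (q * r)" "coprime u' (p * r)" "coprime v' (q * r)"
  shows "M_class u v \<otimes>\<^bsub>Cl a b c\<^esub> M_class u' v' = M_class (u * u') (v * v')"
  using ICM_mult_class[OF fractional_ideal_M[OF assms(1,2)] fractional_ideal_M[OF assms(3,4)]]
    span_prod_M[OF assms(3,4), of u v]
  by (simp add: Cl_def M_class_def \<tau>_span_prod)

lemma one_Cl: "\<one>\<^bsub>Cl a b c\<^esub> = M_class 1 1"
  by (simp add: Cl_def ICM_def M_class_def image_R_to_K\<^sub>0)

text \<open>
  Scaling by a unit of \<open>\<rat>\<^sup>3\<close> does not change the class, so \<open>invertible_R_module_cases\<close> shows that the classes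
  of the twists exhaust the class group.
\<close>

lemma carrier_Cl:
  "carrier (Cl a b c) = {M_class u v | u v. coprime u (p * r) \<and> coprime v (q * r)}"
proof -
  have carrier: "carrier (Cl a b c) = (\<lambda>I. ideal_equiv a b c `` {I}) ` {I. invertible_ideal a b c I}"
    unfolding Cl_def quotient_def by auto
  show ?thesis
  proof
    show "{M_class u v | u v. coprime u (p * r) \<and> coprime v (q * r)} \<subseteq> carrier (Cl a b c)"
      unfolding carrier M_class_def using invertible_M by blast
    show "carrier (Cl a b c) \<subseteq> {M_class u v | u v. coprime u (p * r) \<and> coprime v (q * r)}"
    proof
      fix C assume "C \<in> carrier (Cl a b c)"
      then obtain I J where C: "C = ideal_equiv a b c `` {I}"
        and I: "fractional_ideal a b c I" and J: "fractional_ideal a b c J"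
        and IJ: "ideal_prod K I J = R_to_K\<^sub>0 a b c ` carrier (order_R a b c)"
        unfolding carrier invertible_ideal_def by blast
      obtain A where A: "I = \<tau> ` A" using \<tau>_image_cases[OF fractional_ideal_subset[OF I]] by blast
      obtain B where B: "J = \<tau> ` B" using \<tau>_image_cases[OF fractional_ideal_subset[OF J]] by blast
      have "A \<star> B = M 1 1" using IJ unfolding A B \<tau>_span_prod image_R_to_K\<^sub>0 by simp
      then obtain k k' u v where kk': "k * k' = 1" and uv: "coprime u (p * r)" "coprime v (q * r)"
        and kA: "(\<lambda>s. k * s) ` A = M u v"
        using R_module_if_fractional_ideal I J unfolding A B by (metis invertible_R_module_cases)
      have "(\<tau> ` M u v, I) \<in> ideal_equiv a b c"
        unfolding ideal_equiv_def
        using fractional_ideal_M[OF uv] I \<tau>_Units[OF kk'] \<tau>_scale[of k A] by (auto simp: kA A)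
      then have "M_class u v = C"
        unfolding M_class_def C by (rule equiv_class_eq[OF equiv_ideal_equiv])
      with uv show "C \<in> {M_class u v | u v. coprime u (p * r) \<and> coprime v (q * r)}" by blast
    qed
  qed
qed

text \<open>
  A class is trivial iff the ideal is principal; \<open>M_principal_iff\<close> reduces generators to signs.
\<close>

lemma M_class_eq_one_iff:
  assumes u: "coprime u (p * r)" and v: "coprime v (q * r)"
  shows "M_class u v = M_class 1 1 \<longleftrightarrow> (\<exists>e f. is_sign e \<and> is_sign f \<and> M (e * u) (f * v) = M 1 1)"
proof
  assume "M_class u v = M_class 1 1"
  then have "(\<tau> ` M u v, \<tau> ` M 1 1) \<in> ideal_equiv a b c"
    unfolding M_class_def using eq_equiv_class[OF _ equiv_ideal_equiv] fractional_ideal_M[of 1 1] by auto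
  then obtain x where "x \<in> Units K" "\<tau> ` M u v = x <#\<^bsub>K\<^esub> (\<tau> ` M 1 1)"
    unfolding ideal_equiv_def by blast
  moreover from this obtain k where "x = \<tau> k"
    unfolding Units_def carrier_K by blast
  ultimately have "M u v = (\<lambda>s. k * s) ` M 1 1" by (simp add: \<tau>_scale)
  then show "\<exists>e f. is_sign e \<and> is_sign f \<and> M (e * u) (f * v) = M 1 1"
    using M_principal_iff[OF u v] by blast
next
  assume "\<exists>e f. is_sign e \<and> is_sign f \<and> M (e * u) (f * v) = M 1 1"
  then obtain e f where e: "is_sign e" and f: "is_sign f" and one: "M (e * u) (f * v) = M 1 1" by blast
  have "int_triple e 1 f * int_triple e 1 f = 1" using e f by (auto simp: one_eq_int_triple)
  then have "\<tau> (int_triple e 1 f) \<in> Units K" by (rule \<tau>_Units)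
  moreover have "\<tau> ` M u v = \<tau> (int_triple e 1 f) <#\<^bsub>K\<^esub> (\<tau> ` M 1 1)"
    using M_scale_signs_self[OF e f, of u v] by (simp add: \<tau>_scale one)
  ultimately have "(\<tau> ` M u v, \<tau> ` M 1 1) \<in> ideal_equiv a b c"
    unfolding ideal_equiv_def using fractional_ideal_M[OF u v] fractional_ideal_M[of 1 1] by auto
  then show "M_class u v = M_class 1 1"
    unfolding M_class_def by (rule equiv_class_eq[OF equiv_ideal_equiv])
qed

end

section \<open>The class group as a quotient of a unit group\<close>

lemma group_units_residue_ring:
  assumes "1 < m"
  shows "comm_group (units_of (residue_ring m))"
  using comm_monoid.units_comm_group[OF residues.comm_monoid] assms by (simp add: residues_def)

lemma mod_in_units_residue_ring_iff:
  assumes "1 < m"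
  shows "u mod m \<in> carrier (units_of (residue_ring m)) \<longleftrightarrow> coprime u m"
proof -
  have "residues m" using assms by (simp add: residues_def)
  then have "u mod m \<in> carrier (units_of (residue_ring m)) \<longleftrightarrow>
      0 < u mod m \<and> u mod m < m \<and> coprime (u mod m) m"
    by (simp add: units_of_carrier residues.res_units_eq)
  also have "\<dots> \<longleftrightarrow> coprime u m"
  proof -
    have "u mod m \<noteq> 0" if "coprime u m" using that assms by (auto simp: mod_eq_0_iff_dvd)
    moreover have "0 \<le> u mod m" "u mod m < m" "m \<noteq> 0" using assms by simp_all
    ultimately show ?thesis unfolding coprime_mod_left_iff[OF \<open>m \<noteq> 0\<close>] by linarith
  qed
  finally show ?thesis .
qed

lemma mem_units_residue_ring_mod:
  assumes "1 < m" "x \<in> carrier (units_of (residue_ring m))"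
  shows "x mod m = x"
  using assms residues.res_units_eq[of m] by (simp add: residues_def units_of_carrier)

context cubic
begin

abbreviation G :: "(int \<times> int) monoid"
  where "G \<equiv> grp_G a b c"

abbreviation pair :: "int \<Rightarrow> int \<Rightarrow> int \<times> int"
  where "pair \<equiv> residue_pair a b c"

lemma r_gt_one: "1 < r"
  using p_pos q_pos r_eq by simp

lemma moduli_gt_one: "1 < p * r" "1 < q * r"
  using r_gt_one p_pos q_pos mult_right_mono[of 1 p r] mult_right_mono[of 1 q r] by linarith+

lemma moduli: "(b - a) * (c - a) = p * r" "(c - b) * (c - a) = q * r"
  by (simp_all add: p_def q_def r_def)

lemma G_eq: "G = units_of (residue_ring (p * r)) \<times>\<times> units_of (residue_ring (q * r))"
  by (simp add: grp_G_def moduli)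

lemma pair_eq: "pair u v = (u mod (p * r), v mod (q * r))"
  by (simp add: residue_pair_def moduli)

lemma pair_in_G_iff: "pair u v \<in> carrier G \<longleftrightarrow> coprime u (p * r) \<and> coprime v (q * r)"
  by (simp add: G_eq pair_eq mod_in_units_residue_ring_iff moduli_gt_one)

lemma G_cases:
  assumes "x \<in> carrier G"
  obtains u v where "x = pair u v" "coprime u (p * r)" "coprime v (q * r)"
proof -
  obtain u v where x: "x = (u, v)" by (cases x)
  then have "x = pair u v"
    using assms mem_units_residue_ring_mod moduli_gt_one by (simp add: G_eq pair_eq)
  with assms show thesis using that pair_in_G_iff by simp
qed

lemma pair_mult: "pair u v \<otimes>\<^bsub>G\<^esub> pair u' v' = pair (u * u') (v * v')"
  by (simp add: G_eq pair_eq units_of_mult residue_ring_def mod_mult_eq)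

lemma one_G: "\<one>\<^bsub>G\<^esub> = pair 1 1"
  using moduli_gt_one by (simp add: G_eq pair_eq units_of_one residue_ring_def)

lemma comm_group_G: "comm_group G"
proof -
  have "group G"
    unfolding G_eq using group_units_residue_ring moduli_gt_one
    by (intro DirProd_group) (auto simp: comm_group_def)
  then show ?thesis
  proof (rule group.group_comm_groupI)
    fix x y assume "x \<in> carrier G" "y \<in> carrier G"
    then show "x \<otimes>\<^bsub>G\<^esub> y = y \<otimes>\<^bsub>G\<^esub> x"
      by (elim G_cases) (simp add: pair_mult mult.commute)
  qed
qed

lemma pair_inverse:
  assumes "p * r dvd u * u' - 1" "q * r dvd v * v' - 1"
    "coprime u (p * r)" "coprime v (q * r)" "coprime u' (p * r)" "coprime v' (q * r)"
  shows "inv\<^bsub>G\<^esub> pair u v = pair u' v'"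
proof -
  interpret G: comm_group G by (rule comm_group_G)
  have "pair (u' * u) (v' * v) = pair 1 1"
    using assms(1,2) by (simp add: pair_eq mod_eq_dvd_iff mult.commute)
  then have "pair u' v' \<otimes>\<^bsub>G\<^esub> pair u v = \<one>\<^bsub>G\<^esub>" by (simp add: pair_mult one_G)
  then show ?thesis using assms by (intro G.inv_equality) (simp_all add: pair_in_G_iff)
qed

lemma pair_eq_imp_M_eq: "pair u v = pair u' v' \<Longrightarrow> M u v = M u' v'"
  unfolding pair_eq by (metis M_mod prod.inject)

lemma coprime_sign: "is_sign e \<Longrightarrow> coprime e n"
  by auto

lemma coprime_sign_mult: "is_sign e \<Longrightarrow> coprime (e * u) n \<longleftrightarrow> coprime u n"
  by auto

lemma sub_H_iff: "x \<in> sub_H a b c \<longleftrightarrow> (\<exists>e f. is_sign e \<and> is_sign f \<and> x = pair e f)"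
  unfolding sub_H_def by blast

text \<open>
  The subgroup \<open>K\<close> collects the pairs whose ideal is \<open>R\<close> itself. This makes the independence of
  representatives and the closure properties of \<open>K\<close> evident.
\<close>

lemma pair_in_sub_K_iff:
  assumes "coprime u (p * r)" "coprime v (q * r)"
  shows "pair u v \<in> sub_K a b c \<longleftrightarrow> M u v = M 1 1"
proof -
  have K: "sub_K a b c = {pair u v | u v. pair u v \<in> carrier G \<and> 1 \<in> M u v}"
    unfolding sub_K_def one_in_M_iff p_def q_def r_def by simp
  have G: "pair u v \<in> carrier G" using assms by (simp add: pair_in_G_iff)
  show ?thesis
  proof
    assume "pair u v \<in> sub_K a b c"
    then obtain u' v' where "pair u v = pair u' v'" "1 \<in> M u' v'" unfolding K by blast
    then have "1 \<in> M u v" using pair_eq_imp_M_eq by blast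
    then show "M u v = M 1 1" using M_eq_M11_iff[OF assms] by blast
  next
    assume "M u v = M 1 1"
    then have "1 \<in> M u v" using one_in_M11 by simp
    then show "pair u v \<in> sub_K a b c" unfolding K using G by blast
  qed
qed

lemma sub_K_cases:
  assumes "x \<in> sub_K a b c"
  obtains u v where "x = pair u v" "coprime u (p * r)" "coprime v (q * r)" "M u v = M 1 1"
proof -
  from assms have "x \<in> carrier G" unfolding sub_K_def by blast
  then obtain u v where "x = pair u v" "coprime u (p * r)" "coprime v (q * r)" by (rule G_cases)
  with assms show thesis using that pair_in_sub_K_iff by blast
qed

lemma subgroup_sub_H: "subgroup (sub_H a b c) G"
proof -
  interpret G: comm_group G by (rule comm_group_G)
  show ?thesis
  proof (rule G.subgroupI)
    show "sub_H a b c \<subseteq> carrier G"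
    proof
      fix x assume "x \<in> sub_H a b c"
      then show "x \<in> carrier G"
        unfolding sub_H_iff using pair_in_G_iff coprime_sign by blast
    qed
    show "sub_H a b c \<noteq> {}" unfolding sub_H_def by blast
    show "inv\<^bsub>G\<^esub> x \<in> sub_H a b c" if "x \<in> sub_H a b c" for x
    proof -
      from that obtain e f where e: "is_sign e" and f: "is_sign f" and x: "x = pair e f"
        unfolding sub_H_iff by blast
      have "inv\<^bsub>G\<^esub> pair e f = pair e f"
        by (rule pair_inverse) (use e f coprime_sign in auto)
      then show ?thesis using that x by simp
    qed
    show "x \<otimes>\<^bsub>G\<^esub> y \<in> sub_H a b c" if "x \<in> sub_H a b c" "y \<in> sub_H a b c" for x y
    proof -
      from that obtain e f e' f' where sg: "is_sign e" "is_sign f" "is_sign e'" "is_sign f'"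
        and x: "x = pair e f" "y = pair e' f'"
        unfolding sub_H_iff by blast
      have "is_sign (e * e')" "is_sign (f * f')" using sg by auto
      then show ?thesis unfolding x pair_mult sub_H_iff by blast
    qed
  qed
qed

lemma subgroup_sub_K: "subgroup (sub_K a b c) G"
proof -
  interpret G: comm_group G by (rule comm_group_G)
  show ?thesis
  proof (rule G.subgroupI)
    show "sub_K a b c \<subseteq> carrier G" unfolding sub_K_def by blast
    have "pair 1 1 \<in> sub_K a b c" by (subst pair_in_sub_K_iff) simp_all
    then show "sub_K a b c \<noteq> {}" by blast
    show "inv\<^bsub>G\<^esub> x \<in> sub_K a b c" if x: "x \<in> sub_K a b c" for x
    proof -
      from x obtain u v where x: "x = pair u v" and u: "coprime u (p * r)" and v: "coprime v (q * r)"
        and M: "M u v = M 1 1" by (rule sub_K_cases)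
      obtain u' where u': "p * r dvd u * u' - 1" "coprime u' (p * r)" using unit_inverse[OF u] .
      obtain v' where v': "q * r dvd v * v' - 1" "coprime v' (q * r)" using unit_inverse[OF v] .
      have "M u' v' = M 1 1"
        using M_mult_inverse[OF u'(1) v'(1)] span_prod_M11[OF R_module_M, of u' v'] unfolding M by simp
      then show ?thesis
        unfolding x pair_inverse[OF u'(1) v'(1) u v u'(2) v'(2)]
        using pair_in_sub_K_iff[OF u'(2) v'(2)] by blast
    qed
    show "x \<otimes>\<^bsub>G\<^esub> y \<in> sub_K a b c" if x: "x \<in> sub_K a b c" and y: "y \<in> sub_K a b c" for x y
    proof -
      from x obtain u v where x: "x = pair u v" and u: "coprime u (p * r)" and v: "coprime v (q * r)"
        and M: "M u v = M 1 1" by (rule sub_K_cases)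
      from y obtain u' v' where y: "y = pair u' v'" and u': "coprime u' (p * r)" and v': "coprime v' (q * r)"
        and M': "M u' v' = M 1 1" by (rule sub_K_cases)
      have "M (u * u') (v * v') = M 1 1"
        using span_prod_M[OF u' v', of u v] span_prod_M11[OF R_module_M, of 1 1] M M' by simp
      moreover have "coprime (u * u') (p * r)" "coprime (v * v') (q * r)" using u v u' v' by simp_all
      ultimately show ?thesis unfolding x y pair_mult using pair_in_sub_K_iff by blast
    qed
  qed
qed

text \<open>
  If \<open>e\<close> or \<open>f\<close> is \<open>-1\<close>, the conditions of \<open>K\<close> make \<open>r\<close> divide \<open>- 2 / q\<close>, \<open>2 / p\<close> or \<open>2 / q + 2 / p\<close>. The first two
  are nonzero of absolute value at most \<open>2\<close>. The last requires \<open>p, q \<le> 2\<close>, so \<open>p = q = 2\<close> and \<open>r = 4\<close>, where its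
  value is \<open>2\<close>.
\<close>

lemma sub_H_Int_sub_K:
  assumes r: "4 \<le> r"
  shows "sub_H a b c \<inter> sub_K a b c = {\<one>\<^bsub>G\<^esub>}"
proof
  interpret G: comm_group G by (rule comm_group_G)
  show "{\<one>\<^bsub>G\<^esub>} \<subseteq> sub_H a b c \<inter> sub_K a b c"
    using subgroup.one_closed[OF subgroup_sub_H] subgroup.one_closed[OF subgroup_sub_K] by simp
  show "sub_H a b c \<inter> sub_K a b c \<subseteq> {\<one>\<^bsub>G\<^esub>}"
  proof
    fix x assume x: "x \<in> sub_H a b c \<inter> sub_K a b c"
    then have "x \<in> sub_H a b c" by blast
    then obtain e f where e: "is_sign e" and f: "is_sign f" and xef: "x = pair e f"
      unfolding sub_H_iff by blast
    have "pair e f \<in> sub_K a b c" using x xef by blast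
    then have "M e f = M 1 1"
      by (simp only: pair_in_sub_K_iff[OF coprime_sign[OF e] coprime_sign[OF f]])
    then have "1 \<in> M e f" using one_in_M11 by simp
    then have cond: "p dvd e - 1" "q dvd f - 1" "r dvd e * (f - 1) div q - (e - 1) div p"
      unfolding one_in_M_iff by auto
    have divisor_2: "n = 1 \<or> n = 2" if "n dvd - 2" "0 < n" for n :: int
      using that zdvd_imp_le[of n 2] by auto
    have "e = 1 \<and> f = 1"
    proof (rule ccontr)
      assume "\<not> (e = 1 \<and> f = 1)"
      with e f consider "e = 1" "f = - 1" | "e = - 1" "f = 1" | "e = - 1" "f = - 1" by auto
      then show False
      proof cases
        case 1
        then have "q = 1 \<or> q = 2" using cond(2) divisor_2[of q] q_pos by simp
        then have "r dvd 2 \<or> r dvd 1" using cond(3) 1 by auto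
        then show False using r by (auto dest: zdvd_imp_le)
      next
        case 2
        then have "p = 1 \<or> p = 2" using cond(1) divisor_2[of p] p_pos by simp
        then have "r dvd 2 \<or> r dvd 1" using cond(3) 2 by auto
        then show False using r by (auto dest: zdvd_imp_le)
      next
        case 3
        then have "q = 1 \<or> q = 2" "p = 1 \<or> p = 2"
          using cond(1,2) divisor_2[of q] divisor_2[of p] p_pos q_pos by simp_all
        then have pq: "p = 2" "q = 2" using r r_eq by auto
        then have "r = 4" using r_eq by simp
        then show False using cond(3) 3 pq by simp
      qed
    qed
    then show "x \<in> {\<one>\<^bsub>G\<^esub>}" by (simp add: xef one_G)
  qed
qed

definition class_map :: "int \<times> int \<Rightarrow> rat poly set set set"
  where "class_map x = M_class (fst x) (snd x)"

lemma class_map_pair: "class_map (pair u v) = M_class u v"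
  by (simp add: class_map_def M_class_def pair_eq M_mod)

lemma image_class_map: "class_map ` carrier G = carrier (Cl a b c)"
  unfolding carrier_Cl
proof
  show "class_map ` carrier G \<subseteq> {M_class u v | u v. coprime u (p * r) \<and> coprime v (q * r)}"
  proof clarify
    fix x assume "x \<in> carrier G"
    then show "\<exists>u v. class_map x = M_class u v \<and> coprime u (p * r) \<and> coprime v (q * r)"
      by (rule G_cases) (use class_map_pair in blast)
  qed
  show "{M_class u v | u v. coprime u (p * r) \<and> coprime v (q * r)} \<subseteq> class_map ` carrier G"
    using class_map_pair pair_in_G_iff by blast
qed

lemma class_map_hom: "class_map \<in> hom G (Cl a b c)"
proof (rule homI)
  fix x assume "x \<in> carrier G"
  then show "class_map x \<in> carrier (Cl a b c)" using image_class_map by blast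
next
  fix x y assume "x \<in> carrier G" "y \<in> carrier G"
  then show "class_map (x \<otimes>\<^bsub>G\<^esub> y) = class_map x \<otimes>\<^bsub>Cl a b c\<^esub> class_map y"
    by (elim G_cases) (simp add: pair_mult class_map_pair M_class_mult)
qed

text \<open>
  The group axioms are inherited from \<open>G\<close> along the surjection \<open>class_map\<close>.
\<close>

lemma group_Cl: "group (Cl a b c)"
proof -
  interpret G: comm_group G by (rule comm_group_G)
  have "group ((Cl a b c)\<lparr>carrier := class_map ` carrier G, one := class_map \<one>\<^bsub>G\<^esub>\<rparr>)"
    by (rule G.hom_imp_img_group[OF class_map_hom])
  moreover have "class_map \<one>\<^bsub>G\<^esub> = \<one>\<^bsub>Cl a b c\<^esub>" by (simp add: one_G class_map_pair one_Cl)
  ultimately show ?thesis by (simp add: image_class_map)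
qed

text \<open>
  The class of \<open>M u v\<close> is trivial iff \<open>M (e u) (f v) = R\<close> for some signs \<open>e, f\<close>, that is iff \<open>(e u, f v) \<in> K\<close>.
  As signs are their own inverses, this says that \<open>(u, v)\<close> lies in the product of \<open>(e, f) \<in> H\<close> with \<open>K\<close>.
\<close>

lemma kernel_class_map: "kernel G (Cl a b c) class_map = sub_H a b c <#>\<^bsub>G\<^esub> sub_K a b c"
proof
  have ker: "pair u v \<in> kernel G (Cl a b c) class_map \<longleftrightarrow>
      (\<exists>e f. is_sign e \<and> is_sign f \<and> M (e * u) (f * v) = M 1 1)"
    if "coprime u (p * r)" "coprime v (q * r)" for u v
    using that by (simp add: kernel_def pair_in_G_iff class_map_pair one_Cl M_class_eq_one_iff)
  show "kernel G (Cl a b c) class_map \<subseteq> sub_H a b c <#>\<^bsub>G\<^esub> sub_K a b c"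
  proof
    fix x assume x: "x \<in> kernel G (Cl a b c) class_map"
    then have "x \<in> carrier G" by (simp add: kernel_def)
    then obtain u v where xuv: "x = pair u v" and u: "coprime u (p * r)" and v: "coprime v (q * r)"
      by (rule G_cases)
    from x ker[OF u v] obtain e f where e: "is_sign e" and f: "is_sign f"
      and M: "M (e * u) (f * v) = M 1 1" unfolding xuv by blast
    have "pair (e * u) (f * v) \<in> sub_K a b c"
      using pair_in_sub_K_iff coprime_sign_mult e f u v M by blast
    moreover have "pair e f \<in> sub_H a b c" using e f sub_H_iff by blast
    moreover have "x = pair e f \<otimes>\<^bsub>G\<^esub> pair (e * u) (f * v)"
      using e f unfolding xuv pair_mult by auto
    ultimately show "x \<in> sub_H a b c <#>\<^bsub>G\<^esub> sub_K a b c" unfolding set_mult_def by blast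
  qed
  show "sub_H a b c <#>\<^bsub>G\<^esub> sub_K a b c \<subseteq> kernel G (Cl a b c) class_map"
  proof
    fix x assume "x \<in> sub_H a b c <#>\<^bsub>G\<^esub> sub_K a b c"
    then obtain y z where y: "y \<in> sub_H a b c" and z: "z \<in> sub_K a b c" and x: "x = y \<otimes>\<^bsub>G\<^esub> z"
      unfolding set_mult_def by blast
    obtain e f where e: "is_sign e" and f: "is_sign f" and yef: "y = pair e f"
      using y unfolding sub_H_iff by blast
    from z obtain u v where zuv: "z = pair u v" and u: "coprime u (p * r)" and v: "coprime v (q * r)"
      and M: "M u v = M 1 1" by (rule sub_K_cases)
    have "e * (e * u) = u" "f * (f * v) = v" using e f by auto
    then have "M (e * (e * u)) (f * (f * v)) = M 1 1" by (simp only: M)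
    then show "x \<in> kernel G (Cl a b c) class_map"
      unfolding x yef zuv pair_mult using ker coprime_sign_mult e f u v by blast
  qed
qed

text \<open>
  Here \<open>(p, q)\<close> is \<open>(1, 1)\<close>, \<open>(1, 2)\<close> or \<open>(2, 1)\<close>, so that both moduli only have signs as unit residues.
\<close>

lemma trivial_Cl:
  assumes r: "r \<le> 3"
  shows "trivial_group (Cl a b c)"
proof -
  have "p = 1 \<and> q = 1 \<or> p = 1 \<and> q = 2 \<or> p = 2 \<and> q = 1"
    using r r_eq p_pos q_pos by auto
  then have m: "p * r = 2 \<or> p * r = 3 \<or> p * r = 6" "q * r = 2 \<or> q * r = 3 \<or> q * r = 6"
    using r_eq by auto
  have "M_class u v = M_class 1 1" if u: "coprime u (p * r)" and v: "coprime v (q * r)" for u v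
  proof -
    obtain e where e: "is_sign e" "p * r dvd e * u - 1" using sign_residue[OF m(1) u] .
    obtain f where f: "is_sign f" "q * r dvd f * v - 1" using sign_residue[OF m(2) v] .
    have "pair (e * u) (f * v) = pair 1 1"
      using e(2) f(2) by (simp add: pair_eq mod_eq_dvd_iff)
    then have "M (e * u) (f * v) = M 1 1" by (rule pair_eq_imp_M_eq)
    then show ?thesis using M_class_eq_one_iff[OF u v] e(1) f(1) by blast
  qed
  moreover have "coprime 1 (p * r)" "coprime 1 (q * r)" by simp_all
  ultimately have "carrier (Cl a b c) = {\<one>\<^bsub>Cl a b c\<^esub>}"
    unfolding carrier_Cl one_Cl by blast
  then show ?thesis using group_Cl by (simp add: trivial_group_def)
qed

lemma Cl_iso_quotient:
  assumes r: "4 \<le> r"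
  shows "\<exists>N. N \<lhd> G \<and> internal_direct_product G N (sub_H a b c) (sub_K a b c) \<and> Cl a b c \<cong> G Mod N"
proof (intro exI conjI)
  interpret G: comm_group G by (rule comm_group_G)
  interpret Cl: group "Cl a b c" by (rule group_Cl)
  interpret h: group_hom G "Cl a b c" class_map
    by unfold_locales (rule class_map_hom)
  let ?H = "sub_H a b c" and ?K = "sub_K a b c"
  let ?N = "?H <#>\<^bsub>G\<^esub> ?K"
  show N: "?N \<lhd> G" using h.normal_kernel unfolding kernel_class_map .
  then have sub_N: "subgroup ?N G" by (rule normal_imp_subgroup)
  have "?H \<subseteq> ?N"
    using subgroup.one_closed[OF subgroup_sub_K] subgroup.mem_carrier[OF subgroup_sub_H]
    unfolding set_mult_def by force
  then have H: "subgroup ?H (G\<lparr>carrier := ?N\<rparr>)" by (rule G.subgroup_incl[OF subgroup_sub_H sub_N])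
  have "?K \<subseteq> ?N"
    using subgroup.one_closed[OF subgroup_sub_H] subgroup.mem_carrier[OF subgroup_sub_K]
    unfolding set_mult_def by force
  then have K: "subgroup ?K (G\<lparr>carrier := ?N\<rparr>)" by (rule G.subgroup_incl[OF subgroup_sub_K sub_N])
  have "comm_group (G\<lparr>carrier := ?N\<rparr>)"
    by (rule group.group_comm_groupI[OF subgroup.subgroup_is_group[OF sub_N G.is_group]])
      (simp add: G.m_comm subgroup.mem_carrier[OF sub_N])
  note normal = comm_group.subgroup_imp_normal[OF this]
  show "internal_direct_product G ?N ?H ?K"
    unfolding internal_direct_product_def
    using sub_H_Int_sub_K[OF r] normal[OF H] normal[OF K] by blast
  have "G Mod ?N \<cong> Cl a b c"
    using h.FactGroup_iso[OF image_class_map] unfolding kernel_class_map .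
  then show "Cl a b c \<cong> G Mod ?N"
    by (rule group.iso_sym[OF normal.factorgroup_is_group[OF N]])
qed

end

theorem theorem5p3:
  fixes a b c :: int
  assumes "a < b" and "b < c"
  shows "(c - a \<le> 3 \<longrightarrow> trivial_group (Cl a b c)) \<and>
         (c - a \<ge> 4 \<longrightarrow>
            subgroup (sub_H a b c) (grp_G a b c) \<and>
            subgroup (sub_K a b c) (grp_G a b c) \<and>
            (\<exists>N. N \<lhd> grp_G a b c \<and>
                 internal_direct_product (grp_G a b c) N (sub_H a b c) (sub_K a b c) \<and>
                 Cl a b c \<cong> grp_G a b c Mod N))"
proof -
  interpret cubic a b c using assms by unfold_locales
  show ?thesis
    using trivial_Cl subgroup_sub_H subgroup_sub_K Cl_iso_quotient unfolding r_def by blast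
qed

end
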